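(* Let $\mathscr{H}$ be a nonzero complex Hilbert space, let $A,B \in \mathbb{B}(\mathscr{H})$ be positive operators, let $m$ be a real number such that $A - B \geq m > 0$, and let $0<r\leq 1$. Then $$A^{r} - B^{r} \geq \|A\|^r-(\|A\|-m)^r.$$
   Context: $\mathbb{B}(\mathscr{H})$ denotes the algebra of all bounded linear operators on $\mathscr{H}$ with the operator norm $\|\cdot\|$. For self-adjoint $S,T\in\mathbb{B}(\mathscr{H})$, $S\geq T$ means $\langle Sx,x\rangle\geq\langle Tx,x\rangle$ for all $x\in\mathscr{H}$; $S$ is positive if $S\geq 0$ (positive operators are in particular self-adjoint and need not be invertible). Powers $A^r$, $B^r$ are defined by the continuous functional calculus. A real scalar $c$ in an operator inequality stands for $cI$, with $I$ the identity operator; thus $A-B\geq m>0$ means that $m$ is a positive real number and $A-B\geq mI$. *)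

theory Defs
  imports "HOL-Analysis.Analysis" "HOL-Computational_Algebra.Polynomial"
begin

text \<open>
  Complex Hilbert spaces, as real Banach spaces carrying a complex scalar multiplication that
  extends the real one and an inner product, linear in its first argument, that induces the norm.
\<close>

class complex_hilbert_space = banach +
  fixes scaleC :: "complex \<Rightarrow> 'a \<Rightarrow> 'a" (infixr \<open>*\<^sub>C\<close> 75)
    and cinner :: "'a \<Rightarrow> 'a \<Rightarrow> complex"
  assumes scaleC_add_right: "c *\<^sub>C (x + y) = c *\<^sub>C x + c *\<^sub>C y"
    and scaleC_add_left: "(c + d) *\<^sub>C x = c *\<^sub>C x + d *\<^sub>C x"
    and scaleC_scaleC: "c *\<^sub>C d *\<^sub>C x = (c * d) *\<^sub>C x"
    and scaleC_one: "1 *\<^sub>C x = x"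
    and scaleR_eq_scaleC: "scaleR a x = complex_of_real a *\<^sub>C x"
    and cinner_commute: "cinner x y = cnj (cinner y x)"
    and cinner_add_left: "cinner (x + y) z = cinner x z + cinner y z"
    and cinner_scaleC_left: "cinner (c *\<^sub>C x) y = c * cinner x y"
    and cinner_self_nonneg: "0 \<le> Re (cinner x x)"
    and cinner_self_eq_0_iff: "cinner x x = 0 \<longleftrightarrow> x = 0"
    and norm_eq_sqrt_cinner: "norm x = sqrt (Re (cinner x x))"

text \<open>
  The library type of bounded linear maps consists of real-linear maps; the bounded operators
  of the complex space are those which are moreover complex homogeneous. The operator norm
  and the algebra operations are the library ones.
\<close>

definition complex_linear_op :: "('a::complex_hilbert_space \<Rightarrow>\<^sub>L 'a) \<Rightarrow> bool" where
  "complex_linear_op T \<longleftrightarrow> (\<forall>c x. blinfun_apply T (c *\<^sub>C x) = c *\<^sub>C blinfun_apply T x)"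

definition selfadjoint_op :: "('a::complex_hilbert_space \<Rightarrow>\<^sub>L 'a) \<Rightarrow> bool" where
  "selfadjoint_op T \<longleftrightarrow> complex_linear_op T \<and>
     (\<forall>x y. cinner (blinfun_apply T x) y = cinner x (blinfun_apply T y))"

text \<open>
  The order on self-adjoint operators. The numbers compared are real by self-adjointness, so
  taking real parts loses nothing.
\<close>

definition op_ge :: "('a::complex_hilbert_space \<Rightarrow>\<^sub>L 'a) \<Rightarrow> ('a \<Rightarrow>\<^sub>L 'a) \<Rightarrow> bool"
    (infix \<open>\<ge>\<^sub>o\<^sub>p\<close> 50) where
  "S \<ge>\<^sub>o\<^sub>p T \<longleftrightarrow> selfadjoint_op S \<and> selfadjoint_op T \<and>
     (\<forall>x. Re (cinner (blinfun_apply S x) x) \<ge> Re (cinner (blinfun_apply T x) x))"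

definition positive_op :: "('a::complex_hilbert_space \<Rightarrow>\<^sub>L 'a) \<Rightarrow> bool" where
  "positive_op T \<longleftrightarrow> T \<ge>\<^sub>o\<^sub>p 0"

definition scalar_op :: "real \<Rightarrow> ('a::complex_hilbert_space \<Rightarrow>\<^sub>L 'a)" where
  "scalar_op c = c *\<^sub>R id_blinfun"

definition op_spectrum :: "('a::complex_hilbert_space \<Rightarrow>\<^sub>L 'a) \<Rightarrow> complex set" where
  "op_spectrum T = {z. \<not> (\<exists>S. complex_linear_op S \<and>
     (\<forall>x. blinfun_apply S (blinfun_apply T x - z *\<^sub>C x) = x \<and>
          blinfun_apply T (blinfun_apply S x) - z *\<^sub>C blinfun_apply S x = x))}"

definition poly_op :: "real poly \<Rightarrow> ('a::complex_hilbert_space \<Rightarrow>\<^sub>L 'a) \<Rightarrow> ('a \<Rightarrow>\<^sub>L 'a)" where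
  "poly_op p T = (\<Sum>i\<le>degree p. coeff p i *\<^sub>R ((\<lambda>S. T o\<^sub>L S) ^^ i) id_blinfun)"

text \<open>
  The continuous functional calculus of a self-adjoint operator T, for real functions f that are
  continuous on the spectrum of T: the operator-norm limit of p n (T), for real polynomials p n
  converging to f uniformly on the spectrum. The spectrum of a self-adjoint operator is a compact
  set of reals, so such polynomials exist, and the limit does not depend on their choice.
\<close>

definition cfc :: "(real \<Rightarrow> real) \<Rightarrow> ('a::complex_hilbert_space \<Rightarrow>\<^sub>L 'a) \<Rightarrow> ('a \<Rightarrow>\<^sub>L 'a)" where
  "cfc f T = (THE S. \<exists>p :: nat \<Rightarrow> real poly.
     uniform_limit {t. complex_of_real t \<in> op_spectrum T} (\<lambda>n t. poly (p n) t) f sequentially \<and>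
     (\<lambda>n. poly_op (p n) T) \<longlonglongrightarrow> S)"

text \<open>
  For an exponent r > 0, the function used is the continuous extension to 0 of the r-th power,
  since 0 powr r = 0.
\<close>

definition op_powr :: "('a::complex_hilbert_space \<Rightarrow>\<^sub>L 'a) \<Rightarrow> real \<Rightarrow> ('a \<Rightarrow>\<^sub>L 'a)" where
  "op_powr T r = cfc (\<lambda>t. t powr r) T"

end

theory Submission
  imports Defs "HOL-Computational_Algebra.Fundamental_Theorem_Algebra"
begin

text \<open>
  Write \<open>N = \<parallel>A\<parallel>\<close>. From \<open>A \<ge> B + m \<ge> m\<close> the spectrum of \<open>A\<close> lies in \<open>[m, N]\<close>, where the function
  \<open>t \<mapsto> t\<^sup>r - (t - m)\<^sup>r\<close> is decreasing because \<open>r \<le> 1\<close>. So \<open>A\<^sup>r - (A - m)\<^sup>r \<ge> N\<^sup>r - (N - m)\<^sup>r\<close>, and it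
  remains to see that \<open>(A - m)\<^sup>r \<ge> B\<^sup>r\<close>, which is the Loewner-Heinz inequality for \<open>A - m \<ge> B \<ge> 0\<close>.

  The functional calculus rests on the inequality \<open>\<parallel>p(T)\<parallel> \<le> sup |p|\<close> over the real points of the
  spectrum of a self-adjoint \<open>T\<close> (\<open>norm_poly_op_le\<close>): it makes the limit in its definition exist,
  independently of the polynomials, and it makes the calculus monotone. The reason for the
  inequality is that a polynomial without roots on the spectrum gives an operator that is bounded
  below, factor by factor over the reals (\<open>bounded_below_poly_op\<close>), while \<open>S\<^sup>2 - \<parallel>S\<parallel>\<^sup>2\<close> is never bounded
  below (\<open>norm_attained_approximately\<close>).

  The Loewner-Heinz inequality is proved without integrals. Consider pairs of positive functions
  \<open>(f, g)\<close> with \<open>f(X) \<ge> g(Y)\<close>. Such pairs are closed under arithmetic means, and, since inversion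
  reverses the order of positive operators, also under harmonic means. Iterating both means
  converges to the geometric mean, so the pairs are closed under geometric means as well
  (\<open>dominates_geometric_mean\<close>). Starting from \<open>(1, 1)\<close> and \<open>(f, g)\<close> one reaches \<open>(f\<^sup>r, g\<^sup>r)\<close> for all
  dyadic \<open>r\<close> in \<open>[0, 1]\<close>, and every \<open>r\<close> in the limit. Working with pairs of functions, here \<open>t - m\<close> on
  the spectrum of \<open>A\<close> and \<open>t\<close> on that of \<open>B\<close>, avoids any comparison of the calculi of \<open>A\<close> and \<open>A - m\<close>.
\<close>

section \<open>The inner product\<close>

lemma cinner_add_right: "cinner x (y + z) = cinner x y + cinner x z"
  by (subst (1 2 3) cinner_commute) (simp add: cinner_add_left)

lemma cinner_scaleC_right: "cinner x (c *\<^sub>C y) = cnj c * cinner x y"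
  by (subst (1 2) cinner_commute) (simp add: cinner_scaleC_left)

lemma cinner_scaleR_left: "cinner (scaleR a x) y = of_real a * cinner x y"
  by (simp add: scaleR_eq_scaleC cinner_scaleC_left)

lemma cinner_scaleR_right: "cinner x (scaleR a y) = of_real a * cinner x y"
  by (simp add: scaleR_eq_scaleC cinner_scaleC_right)

lemma Re_cinner_commute: "Re (cinner x y) = Re (cinner y x)"
  by (subst cinner_commute) simp

lemma Re_cinner_self: "Re (cinner x x) = (norm x)\<^sup>2"
  by (simp add: norm_eq_sqrt_cinner cinner_self_nonneg)

lemma norm_scaleC_ii: "norm (\<i> *\<^sub>C x) = norm x"
  by (simp add: norm_eq_sqrt_cinner cinner_scaleC_left cinner_scaleC_right)

lemma norm_add_square: "(norm (x + y))\<^sup>2 = (norm x)\<^sup>2 + 2 * Re (cinner x y) + (norm y)\<^sup>2"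
  unfolding Re_cinner_self [symmetric]
  by (simp add: cinner_add_left cinner_add_right Re_cinner_commute [of y x])

lemma norm_diff_square:
  fixes x y :: "'a::complex_hilbert_space"
  shows "(norm (x - y))\<^sup>2 = (norm x)\<^sup>2 - 2 * Re (cinner x y) + (norm y)\<^sup>2"
  using norm_add_square [of x "scaleR (-1) y"]
  by (simp only: cinner_scaleR_right) simp

lemma Re_cinner_le: "Re (cinner x y) \<le> norm x * norm y"
proof (cases "x = 0 \<or> y = 0")
  case True
  then show ?thesis
    using cinner_scaleR_left [of 0 x y] cinner_scaleR_right [of x 0 y] by auto
next
  case False
  have "0 \<le> (norm (scaleR (norm y) x - scaleR (norm x) y))\<^sup>2"
    by simp
  also have "\<dots> = 2 * (norm x * norm y) * (norm x * norm y - Re (cinner x y))"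
    unfolding norm_diff_square
    by (simp add: cinner_scaleR_left cinner_scaleR_right power2_eq_square algebra_simps)
  finally show ?thesis
    using False by (auto simp: zero_le_mult_iff mult_le_0_iff)
qed

lemma abs_Re_cinner_le: "\<bar>Re (cinner x y)\<bar> \<le> norm x * norm y"
  using Re_cinner_le [of x y] Re_cinner_le [of "scaleR (-1) x" y]
  by (simp only: cinner_scaleR_left) simp

lemma abs_Im_cinner_le: "\<bar>Im (cinner x y)\<bar> \<le> norm x * norm y"
  using abs_Re_cinner_le [of "\<i> *\<^sub>C x" y] by (simp add: cinner_scaleC_left norm_scaleC_ii)

lemma bounded_bilinear_cinner:
  "bounded_bilinear (cinner :: 'a::complex_hilbert_space \<Rightarrow> 'a \<Rightarrow> complex)"
proof
  show "\<exists>K. \<forall>x y :: 'a. norm (cinner x y) \<le> norm x * norm y * K"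
  proof (intro exI [of _ 2] allI)
    fix x y :: 'a
    show "norm (cinner x y) \<le> norm x * norm y * 2"
      using cmod_le [of "cinner x y"] abs_Re_cinner_le [of x y] abs_Im_cinner_le [of x y]
      by linarith
  qed
qed (simp_all add: cinner_add_left cinner_add_right cinner_scaleR_left cinner_scaleR_right
    scaleR_conv_of_real)

interpretation cinner: bounded_bilinear cinner
  by (rule bounded_bilinear_cinner)

lemma cinner_eqI:
  assumes "\<And>y. cinner x y = cinner z y"
  shows "x = z"
proof -
  have "cinner (x - z) (x - z) = 0"
    by (simp only: cinner.diff_left assms) simp
  then show ?thesis
    by (simp add: cinner_self_eq_0_iff)
qed

section \<open>Self-adjoint operators\<close>

text \<open>Complex homogeneity is a consequence of symmetry for a complex inner product.\<close>

lemma selfadjoint_opI: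
  assumes "\<And>x y. cinner (blinfun_apply T x) y = cinner x (blinfun_apply T y)"
  shows "selfadjoint_op T"
proof -
  have "blinfun_apply T (c *\<^sub>C x) = c *\<^sub>C blinfun_apply T x" for c x
    by (rule cinner_eqI) (simp add: assms cinner_scaleC_left)
  then show ?thesis
    using assms by (simp add: selfadjoint_op_def complex_linear_op_def)
qed

lemma selfadjoint_opD:
  "selfadjoint_op T \<Longrightarrow> cinner (blinfun_apply T x) y = cinner x (blinfun_apply T y)"
  by (simp add: selfadjoint_op_def)

lemma selfadjoint_op_zero: "selfadjoint_op 0"
  by (rule selfadjoint_opI) (simp add: cinner.zero_left cinner.zero_right)

lemma selfadjoint_op_id: "selfadjoint_op id_blinfun"
  by (rule selfadjoint_opI) simp

lemma selfadjoint_op_add: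
  "selfadjoint_op S \<Longrightarrow> selfadjoint_op T \<Longrightarrow> selfadjoint_op (S + T)"
  by (rule selfadjoint_opI)
    (simp add: selfadjoint_opD blinfun.add_left cinner_add_left cinner_add_right)

lemma selfadjoint_op_scaleR: "selfadjoint_op S \<Longrightarrow> selfadjoint_op (a *\<^sub>R S)"
  by (rule selfadjoint_opI)
    (simp add: selfadjoint_opD blinfun.scaleR_left cinner_scaleR_left cinner_scaleR_right)

lemma selfadjoint_op_diff:
  "selfadjoint_op S \<Longrightarrow> selfadjoint_op T \<Longrightarrow> selfadjoint_op (S - T)"
  by (rule selfadjoint_opI)
    (simp add: selfadjoint_opD blinfun.diff_left cinner.diff_left cinner.diff_right)

lemma selfadjoint_op_scalar: "selfadjoint_op (scalar_op c)"
  unfolding scalar_op_def by (intro selfadjoint_op_scaleR selfadjoint_op_id)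

lemma selfadjoint_op_compose:
  assumes "selfadjoint_op S" "selfadjoint_op T" "S o\<^sub>L T = T o\<^sub>L S"
  shows "selfadjoint_op (S o\<^sub>L T)"
proof (rule selfadjoint_opI)
  fix x y
  have "cinner (blinfun_apply (S o\<^sub>L T) x) y = cinner x (blinfun_apply (T o\<^sub>L S) y)"
    using assms(1,2) by (simp add: selfadjoint_opD)
  then show "cinner (blinfun_apply (S o\<^sub>L T) x) y = cinner x (blinfun_apply (S o\<^sub>L T) y)"
    by (simp only: assms(3))
qed

lemma tendsto_cinner_blinfun:
  assumes "S \<longlonglongrightarrow> T"
  shows "(\<lambda>n. cinner (blinfun_apply (S n) x) y) \<longlonglongrightarrow> cinner (blinfun_apply T x) y"
  by (intro cinner.tendsto blinfun.tendsto assms tendsto_const)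

lemma selfadjoint_op_limit:
  assumes "\<And>n. selfadjoint_op (S n)" "S \<longlonglongrightarrow> T"
  shows "selfadjoint_op T"
proof (rule selfadjoint_opI)
  fix x y
  have "(\<lambda>n. cinner (blinfun_apply (S n) x) y) \<longlonglongrightarrow> cinner x (blinfun_apply T y)"
    using assms by (simp add: selfadjoint_opD) (intro cinner.tendsto blinfun.tendsto tendsto_const)
  with tendsto_cinner_blinfun [OF assms(2)]
  show "cinner (blinfun_apply T x) y = cinner x (blinfun_apply T y)"
    by (rule LIMSEQ_unique)
qed

lemma op_geD: "S \<ge>\<^sub>o\<^sub>p T \<Longrightarrow> Re (cinner (blinfun_apply T x) x) \<le> Re (cinner (blinfun_apply S x) x)"
  by (simp add: op_ge_def)

lemma op_ge_limit:
  assumes "\<And>n. S n \<ge>\<^sub>o\<^sub>p T n" "S \<longlonglongrightarrow> S'" "T \<longlonglongrightarrow> T'"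
  shows "S' \<ge>\<^sub>o\<^sub>p T'"
  unfolding op_ge_def
proof (intro conjI allI)
  show "selfadjoint_op S'" "selfadjoint_op T'"
    using assms by (auto intro: selfadjoint_op_limit simp: op_ge_def)
  fix x
  show "Re (cinner (blinfun_apply T' x) x) \<le> Re (cinner (blinfun_apply S' x) x)"
  proof (rule LIMSEQ_le)
    show "(\<lambda>n. Re (cinner (blinfun_apply (T n) x) x)) \<longlonglongrightarrow> Re (cinner (blinfun_apply T' x) x)"
      "(\<lambda>n. Re (cinner (blinfun_apply (S n) x) x)) \<longlonglongrightarrow> Re (cinner (blinfun_apply S' x) x)"
      by (intro tendsto_Re tendsto_cinner_blinfun assms(2,3))+
  qed (use assms(1) in \<open>auto simp: op_ge_def\<close>)
qed

section \<open>Invertibility and the spectrum\<close>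

definition inverse_of :: "('a::complex_hilbert_space \<Rightarrow>\<^sub>L 'a) \<Rightarrow> ('a \<Rightarrow>\<^sub>L 'a) \<Rightarrow> bool" where
  "inverse_of W V \<longleftrightarrow> W o\<^sub>L V = id_blinfun \<and> V o\<^sub>L W = id_blinfun"

lemma inverse_of_apply:
  assumes "inverse_of W V"
  shows "blinfun_apply W (blinfun_apply V x) = x" "blinfun_apply V (blinfun_apply W x) = x"
  using assms unfolding inverse_of_def
  by (metis blinfun_apply_blinfun_compose id_blinfun.rep_eq)+

lemma inverse_ofI:
  assumes "\<And>x. blinfun_apply W (blinfun_apply V x) = x"
    and "\<And>x. blinfun_apply V (blinfun_apply W x) = x"
  shows "inverse_of W V"
  using assms by (auto simp: inverse_of_def intro!: blinfun_eqI)

lemma inverse_of_compose: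
  assumes "inverse_of W V" "inverse_of W' V'"
  shows "inverse_of (W' o\<^sub>L W) (V o\<^sub>L V')"
  by (rule inverse_ofI) (simp_all add: inverse_of_apply [OF assms(1)] inverse_of_apply [OF assms(2)])

lemma selfadjoint_op_inverse:
  assumes "selfadjoint_op V" "inverse_of W V"
  shows "selfadjoint_op W"
proof (rule selfadjoint_opI)
  fix x y
  have "cinner (blinfun_apply W x) y
      = cinner (blinfun_apply W x) (blinfun_apply V (blinfun_apply W y))"
    by (simp add: inverse_of_apply [OF assms(2)])
  also have "\<dots> = cinner x (blinfun_apply W y)"
    using selfadjoint_opD [OF assms(1), of "blinfun_apply W x" "blinfun_apply W y"]
    by (simp add: inverse_of_apply [OF assms(2)])
  finally show "cinner (blinfun_apply W x) y = cinner x (blinfun_apply W y)" .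
qed

text \<open>
  Solving \<open>V x = y\<close> means finding a fixed point of \<open>x \<mapsto> y + (x - V x)\<close>, a contraction with constant
  \<open>\<parallel>1 - V\<parallel>\<close>; the contraction estimate also bounds the solution.
\<close>

lemma inverse_near_id:
  assumes "norm (id_blinfun - V) < 1"
  shows "\<exists>W. inverse_of W V"
proof -
  define q where "q = norm (id_blinfun - V)"
  have diff: "blinfun_apply (id_blinfun - V) x = x - blinfun_apply V x" for x
    by (simp add: blinfun.diff_left)
  have q: "0 \<le> q" "q < 1"
    using assms by (auto simp: q_def)
  have contraction: "norm (x - blinfun_apply V x) \<le> q * norm x" for x
    unfolding q_def diff [symmetric] by (rule norm_blinfun)
  have "\<exists>!x. y + (x - blinfun_apply V x) = x" for y
  proof (rule banach_fix_type [OF q])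
    show "\<forall>x z. dist (y + (x - blinfun_apply V x)) (y + (z - blinfun_apply V z)) \<le> q * dist x z"
    proof (intro allI)
      fix x z
      show "dist (y + (x - blinfun_apply V x)) (y + (z - blinfun_apply V z)) \<le> q * dist x z"
        using contraction [of "x - z"] by (simp add: dist_norm blinfun.diff_right algebra_simps)
    qed
  qed
  moreover have "y + (x - blinfun_apply V x) = x \<longleftrightarrow> blinfun_apply V x = y" for x y
    by (auto simp: algebra_simps)
  ultimately have "\<exists>!x. blinfun_apply V x = y" for y
    by simp
  then have "\<forall>y. \<exists>x. blinfun_apply V x = y \<and> (\<forall>z. blinfun_apply V z = y \<longrightarrow> z = x)"
    by blast
  then obtain g where g: "\<And>y. blinfun_apply V (g y) = y"
    and g': "\<And>x y. blinfun_apply V x = y \<Longrightarrow> x = g y"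
    by metis
  have "bounded_linear g"
  proof (rule bounded_linear_intro)
    show "g (x + y) = g x + g y" for x y
      by (rule g' [symmetric]) (simp add: blinfun.add_right g)
    show "g (scaleR a x) = scaleR a (g x)" for a x
      by (rule g' [symmetric]) (simp add: blinfun.scaleR_right g)
    show "norm (g y) \<le> norm y * (1 / (1 - q))" for y
    proof -
      have "norm (g y) \<le> norm y + norm (g y - y)"
        using norm_triangle_sub by blast
      also have "\<dots> \<le> norm y + q * norm (g y)"
        using contraction [of "g y"] by (simp add: g)
      finally show ?thesis
        using q by (simp add: field_simps)
    qed
  qed
  then have "inverse_of (Blinfun g) V"
    by (intro inverse_ofI) (simp_all add: bounded_linear_Blinfun_apply g g' [symmetric])
  then show ?thesis ..
qed

lemma inverse_of_scaleR:
  assumes "d \<noteq> 0" "inverse_of W (d *\<^sub>R V)"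
  shows "inverse_of (d *\<^sub>R W) V"
  using inverse_of_apply [OF assms(2)]
  by (intro inverse_ofI) (simp_all add: blinfun.scaleR_left blinfun.scaleR_right)

text \<open>
  A small multiple \<open>d V\<close> of a coercive operator is close to the identity, because
  \<open>\<parallel>x - d V x\<parallel>\<^sup>2 \<le> (1 - 2 d c + d\<^sup>2 \<parallel>V\<parallel>\<^sup>2) \<parallel>x\<parallel>\<^sup>2\<close>.
\<close>

lemma inverse_of_coercive:
  assumes c: "c > 0" and coercive: "\<And>x. c * (norm x)\<^sup>2 \<le> Re (cinner (blinfun_apply V x) x)"
  shows "\<exists>W. inverse_of W V"
proof -
  define K where "K = norm V + c"
  \<comment> \<open>This \<open>d\<close> minimises \<open>1 - 2 d c + d\<^sup>2 K\<^sup>2\<close>, and \<open>c \<le> K\<close> keeps the minimum nonnegative.\<close>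
  define d where "d = c / K\<^sup>2"
  have K: "K > 0" "c \<le> K" "norm V \<le> K"
    using c by (auto simp: K_def add_nonneg_pos)
  have d: "d > 0"
    using c K by (simp add: d_def)
  define q where "q = 1 - c\<^sup>2 / K\<^sup>2"
  have q: "0 \<le> q" "q < 1"
    using c K by (auto simp: q_def power_mono)
  have "norm (blinfun_apply (id_blinfun - d *\<^sub>R V) x) \<le> sqrt q * norm x" for x
  proof -
    have "norm (blinfun_apply V x) \<le> K * norm x"
      using norm_blinfun [of V x] K(3) by (meson mult_right_mono norm_ge_zero order_trans)
    then have "d\<^sup>2 * (norm (blinfun_apply V x))\<^sup>2 \<le> d\<^sup>2 * (K\<^sup>2 * (norm x)\<^sup>2)"
      by (metis mult_left_mono norm_ge_zero power_mono power_mult_distrib zero_le_power2)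
    also have "\<dots> = d * c * (norm x)\<^sup>2"
      using K by (simp add: d_def power2_eq_square)
    finally have "d\<^sup>2 * (norm (blinfun_apply V x))\<^sup>2 \<le> d * c * (norm x)\<^sup>2" .
    moreover have "d * (c * (norm x)\<^sup>2) \<le> d * Re (cinner (blinfun_apply V x) x)"
      using coercive d by (simp add: mult_left_mono)
    moreover have "(norm (x - d *\<^sub>R blinfun_apply V x))\<^sup>2 = (norm x)\<^sup>2
        - 2 * (d * Re (cinner (blinfun_apply V x) x)) + d\<^sup>2 * (norm (blinfun_apply V x))\<^sup>2"
      using d by (simp add: norm_diff_square cinner_scaleR_right Re_cinner_commute [of x]
          power_mult_distrib)
    moreover have "q * (norm x)\<^sup>2 = (norm x)\<^sup>2 - d * c * (norm x)\<^sup>2"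
    proof -
      have "q = 1 - d * c"
        by (simp add: q_def d_def power2_eq_square)
      then show ?thesis
        by (simp add: left_diff_distrib)
    qed
    ultimately have "(norm (x - d *\<^sub>R blinfun_apply V x))\<^sup>2 \<le> q * (norm x)\<^sup>2"
      by linarith
    then have "sqrt ((norm (x - d *\<^sub>R blinfun_apply V x))\<^sup>2) \<le> sqrt (q * (norm x)\<^sup>2)"
      by (rule real_sqrt_le_mono)
    then show ?thesis
      by (simp add: real_sqrt_mult blinfun.diff_left blinfun.scaleR_left)
  qed
  then have "norm (id_blinfun - d *\<^sub>R V) \<le> sqrt q"
    using q by (intro norm_blinfun_bound) auto
  also have "sqrt q < 1"
    using q by simp
  finally obtain W where "inverse_of W (d *\<^sub>R V)"
    using inverse_near_id by blast
  then show ?thesis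
    using d inverse_of_scaleR [of d W V] by auto
qed

text \<open>
  The set on which the functional calculus measures uniform convergence. For a self-adjoint
  operator it is the whole spectrum.
\<close>

definition real_spectrum :: "('a::complex_hilbert_space \<Rightarrow>\<^sub>L 'a) \<Rightarrow> real set" where
  "real_spectrum T = {t. complex_of_real t \<in> op_spectrum T}"

lemma blinfun_apply_scalar_op [simp]: "blinfun_apply (scalar_op c) x = c *\<^sub>R x"
  by (simp add: scalar_op_def blinfun.scaleR_left)

lemma not_in_real_spectrum_iff:
  assumes "selfadjoint_op T"
  shows "t \<notin> real_spectrum T \<longleftrightarrow> (\<exists>W. inverse_of W (T - scalar_op t))"
proof
  assume "t \<notin> real_spectrum T"
  then obtain W where "\<And>x. blinfun_apply W (blinfun_apply T x - t *\<^sub>R x) = x"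
    "\<And>x. blinfun_apply T (blinfun_apply W x) - t *\<^sub>R blinfun_apply W x = x"
    unfolding real_spectrum_def op_spectrum_def scaleR_eq_scaleC by blast
  then have "inverse_of W (T - scalar_op t)"
    by (intro inverse_ofI) (simp_all add: blinfun.diff_left)
  then show "\<exists>W. inverse_of W (T - scalar_op t)" ..
next
  assume "\<exists>W. inverse_of W (T - scalar_op t)"
  then obtain W where W: "inverse_of W (T - scalar_op t)" ..
  then have "complex_linear_op W"
    using selfadjoint_op_inverse [OF selfadjoint_op_diff [OF assms selfadjoint_op_scalar]]
    by (simp add: selfadjoint_op_def)
  with inverse_of_apply [OF W] show "t \<notin> real_spectrum T"
    unfolding real_spectrum_def op_spectrum_def
    by (auto simp: blinfun.diff_left scaleR_eq_scaleC)
qed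

text \<open>
  If \<open>W\<close> inverts \<open>T - t\<close>, then \<open>T - s = (T - s) W (T - t)\<close>, and \<open>(T - s) W = 1 - (s - t) W\<close> is invertible
  for \<open>s\<close> near \<open>t\<close>.
\<close>

lemma closed_real_spectrum:
  assumes T: "selfadjoint_op T"
  shows "closed (real_spectrum T)"
  unfolding closed_def open_dist
proof (intro ballI)
  fix t assume "t \<in> - real_spectrum T"
  then obtain W where W: "inverse_of W (T - scalar_op t)"
    using not_in_real_spectrum_iff [OF T] by auto
  define e where "e = 1 / (norm W + 1)"
  have "s \<notin> real_spectrum T" if "dist s t < e" for s
  proof -
    have "norm (id_blinfun - ((T - scalar_op s) o\<^sub>L W)) < 1"
    proof -
      have "id_blinfun - ((T - scalar_op s) o\<^sub>L W) = (s - t) *\<^sub>R W"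
        using inverse_of_apply(2) [OF W]
        by (intro blinfun_eqI)
          (simp add: blinfun.add_left blinfun.diff_left blinfun.scaleR_left algebra_simps)
      moreover have "\<bar>s - t\<bar> * norm W \<le> \<bar>s - t\<bar> * (norm W + 1)"
        by (simp add: mult_left_mono)
      moreover have "\<dots> < 1"
        using that by (simp add: e_def dist_real_def pos_less_divide_eq add_nonneg_pos)
      ultimately show ?thesis
        by simp
    qed
    then obtain U where "inverse_of U ((T - scalar_op s) o\<^sub>L W)"
      using inverse_near_id by blast
    from inverse_of_compose [OF this W]
    have "inverse_of (W o\<^sub>L U) (((T - scalar_op s) o\<^sub>L W) o\<^sub>L (T - scalar_op t))" .
    moreover have "((T - scalar_op s) o\<^sub>L W) o\<^sub>L (T - scalar_op t) = T - scalar_op s"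
      by (rule blinfun_eqI) (simp add: inverse_of_apply(1) [OF W])
    ultimately show ?thesis
      using not_in_real_spectrum_iff [OF T] by auto
  qed
  moreover have "e > 0"
    by (simp add: e_def add_nonneg_pos)
  ultimately show "\<exists>e>0. \<forall>s. dist s t < e \<longrightarrow> s \<in> - real_spectrum T"
    by auto
qed

lemma real_spectrum_lower_bound:
  assumes T: "T \<ge>\<^sub>o\<^sub>p scalar_op a" and t: "t \<in> real_spectrum T"
  shows "a \<le> t"
proof (rule ccontr)
  assume "\<not> a \<le> t"
  moreover have "(a - t) * (norm x)\<^sup>2 \<le> Re (cinner (blinfun_apply (T - scalar_op t) x) x)" for x
    using op_geD [OF T, of x]
    by (simp add: blinfun.diff_left cinner.diff_left cinner_scaleR_left Re_cinner_self algebra_simps)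
  ultimately show False
    using inverse_of_coercive [of "a - t" "T - scalar_op t"] t not_in_real_spectrum_iff T
    by (auto simp: op_ge_def)
qed

lemma real_spectrum_le_norm:
  assumes T: "selfadjoint_op T" and t: "t \<in> real_spectrum T"
  shows "\<bar>t\<bar> \<le> norm T"
proof (rule ccontr)
  assume *: "\<not> \<bar>t\<bar> \<le> norm T"
  \<comment> \<open>Scaled in this way, \<open>T - t\<close> becomes \<open>1 - T / t\<close>.\<close>
  define d where "d = - 1 / t"
  have t0: "t \<noteq> 0"
    using * by auto
  have "id_blinfun - d *\<^sub>R (T - scalar_op t) = (1 / t) *\<^sub>R T"
    using t0 by (intro blinfun_eqI) (simp add: d_def blinfun.add_left blinfun.diff_left blinfun.scaleR_left
        algebra_simps)
  moreover have "norm ((1 / t) *\<^sub>R T) < 1"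
    using * t0 by (simp add: field_simps)
  ultimately obtain W where "inverse_of W (d *\<^sub>R (T - scalar_op t))"
    using inverse_near_id by metis
  then show False
    using inverse_of_scaleR [of d] t0 t not_in_real_spectrum_iff [OF T] by (auto simp: d_def)
qed

lemma compact_real_spectrum:
  assumes "selfadjoint_op T"
  shows "compact (real_spectrum T)"
proof -
  have "bounded (real_spectrum T)"
    using real_spectrum_le_norm [OF assms] by (auto simp: bounded_iff)
  then show ?thesis
    by (simp add: compact_eq_bounded_closed closed_real_spectrum assms)
qed

section \<open>Polynomials of an operator\<close>

lemma poly_op_0 [simp]: "poly_op 0 T = 0"
  by (simp add: poly_op_def)

lemma poly_op_pCons: "poly_op (pCons a p) T = a *\<^sub>R id_blinfun + (T o\<^sub>L poly_op p T)"
proof -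
  let ?pow = "\<lambda>i. ((\<lambda>S. T o\<^sub>L S) ^^ i) id_blinfun"
  have "poly_op (pCons a p) T = (\<Sum>i\<le>Suc (degree p). coeff (pCons a p) i *\<^sub>R ?pow i)"
    unfolding poly_op_def by (rule sum.mono_neutral_left) (auto simp: coeff_eq_0)
  also have "\<dots> = a *\<^sub>R id_blinfun + (\<Sum>i\<le>degree p. coeff p i *\<^sub>R (T o\<^sub>L ?pow i))"
    by (subst sum.atMost_Suc_shift) simp
  also have "(\<Sum>i\<le>degree p. coeff p i *\<^sub>R (T o\<^sub>L ?pow i)) = (T o\<^sub>L poly_op p T)"
    unfolding poly_op_def
    by (simp add: bounded_bilinear.sum_right [OF bounded_bilinear_blinfun_compose]
        bounded_bilinear.scaleR_right [OF bounded_bilinear_blinfun_compose])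
  finally show ?thesis .
qed

lemma poly_op_const: "poly_op [:a:] T = scalar_op a"
  by (simp add: poly_op_pCons scalar_op_def)

lemma poly_op_linear: "poly_op [:a, 1:] T = T + scalar_op a"
  by (rule blinfun_eqI) (simp add: poly_op_pCons blinfun.add_left blinfun.scaleR_left)

lemma poly_op_add: "poly_op (p + q) T = poly_op p T + poly_op q T"
  by (induction p q rule: poly_induct2)
    (auto intro!: blinfun_eqI
      simp: poly_op_pCons blinfun.add_left blinfun.add_right blinfun.scaleR_left algebra_simps)

lemma poly_op_smult: "poly_op (smult c p) T = c *\<^sub>R poly_op p T"
  by (induction p)
    (auto intro!: blinfun_eqI
      simp: poly_op_pCons blinfun.add_left blinfun.scaleR_left blinfun.scaleR_right algebra_simps)

lemma poly_op_diff: "poly_op (p - q) T = poly_op p T - poly_op q T"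
  using poly_op_add [of "p - q" q T] by simp

lemma poly_op_mult: "poly_op (p * q) T = (poly_op p T o\<^sub>L poly_op q T)"
  by (induction p)
    (auto intro!: blinfun_eqI
      simp: poly_op_pCons poly_op_add poly_op_smult blinfun.add_left blinfun.scaleR_left)

lemma selfadjoint_poly_op:
  assumes T: "selfadjoint_op T"
  shows "selfadjoint_op (poly_op p T)"
proof (induction p)
  case 0
  show ?case
    by (simp add: selfadjoint_op_zero)
next
  case (pCons a p)
  have "(T o\<^sub>L poly_op p T) = (poly_op p T o\<^sub>L T)"
    using poly_op_mult [of "[:0, 1:]" p T] poly_op_mult [of p "[:0, 1:]" T]
    by (simp only: mult.commute [of p]) (simp add: poly_op_linear scalar_op_def)
  then show ?case
    unfolding poly_op_pCons
    by (intro selfadjoint_op_add selfadjoint_op_scaleR selfadjoint_op_id selfadjoint_op_compose T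
        pCons.IH)
qed

text \<open>
  This is the part of invertibility that the norm estimate uses: it passes to products, and
  approximate eigenvectors refute it.
\<close>

definition bounded_below :: "('a::real_normed_vector \<Rightarrow>\<^sub>L 'a) \<Rightarrow> bool" where
  "bounded_below T \<longleftrightarrow> (\<exists>c>0. \<forall>x. c * norm x \<le> norm (blinfun_apply T x))"

lemma bounded_below_compose:
  assumes "bounded_below S" "bounded_below T"
  shows "bounded_below (S o\<^sub>L T)"
proof -
  obtain c d where c: "c > 0" "\<And>x. c * norm x \<le> norm (blinfun_apply S x)"
    and d: "d > 0" "\<And>x. d * norm x \<le> norm (blinfun_apply T x)"
    using assms by (auto simp: bounded_below_def)
  have "c * d * norm x \<le> norm (blinfun_apply (S o\<^sub>L T) x)" for x
  proof -
    have "c * (d * norm x) \<le> c * norm (blinfun_apply T x)"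
      using c(1) d(2) by (simp add: mult_left_mono)
    also have "\<dots> \<le> norm (blinfun_apply (S o\<^sub>L T) x)"
      using c(2) by simp
    finally show ?thesis
      by (simp add: mult.assoc)
  qed
  with c(1) d(1) show ?thesis
    unfolding bounded_below_def by (intro exI [of _ "c * d"]) auto
qed

lemma bounded_below_of_inverse:
  assumes "inverse_of W V"
  shows "bounded_below V"
proof -
  have "1 / (norm W + 1) * norm x \<le> norm (blinfun_apply V x)" for x
  proof -
    have "norm x \<le> norm W * norm (blinfun_apply V x)"
      using norm_blinfun [of W "blinfun_apply V x"] by (simp add: inverse_of_apply [OF assms])
    also have "\<dots> \<le> (norm W + 1) * norm (blinfun_apply V x)"
      by (simp add: mult_right_mono)
    finally show ?thesis
      by (simp add: pos_divide_le_eq add_nonneg_pos mult.commute)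
  qed
  then show ?thesis
    unfolding bounded_below_def using norm_ge_zero [of W]
    by (intro exI [of _ "1 / (norm W + 1)"]) (auto simp: add_nonneg_pos)
qed

text \<open>
  The quadratic polynomial with the non-real roots \<open>a \<plusminus> b \<i>\<close> is \<open>(t - a)\<^sup>2 + b\<^sup>2\<close>, and
  \<open>\<langle>((T - a)\<^sup>2 + b\<^sup>2) x, x\<rangle> \<ge> b\<^sup>2 \<parallel>x\<parallel>\<^sup>2\<close>.
\<close>

lemma bounded_below_quadratic:
  assumes T: "selfadjoint_op T" and b: "b \<noteq> 0"
  shows "bounded_below (poly_op [:a\<^sup>2 + b\<^sup>2, - 2 * a, 1:] T)"
proof -
  define S where "S = poly_op [:- a, 1:] T"
  define Q where "Q = poly_op [:a\<^sup>2 + b\<^sup>2, - 2 * a, 1:] T"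
  have S: "selfadjoint_op S"
    unfolding S_def by (rule selfadjoint_poly_op [OF T])
  have "[:a\<^sup>2 + b\<^sup>2, - 2 * a, 1:] = [:- a, 1:] * [:- a, 1:] + [:b\<^sup>2:]"
    by (simp add: power2_eq_square)
  then have Q: "Q = (S o\<^sub>L S) + scalar_op (b\<^sup>2)"
    unfolding Q_def S_def by (simp only: poly_op_add poly_op_mult poly_op_const)
  have "b\<^sup>2 * norm x \<le> norm (blinfun_apply Q x)" for x
  proof (cases "x = 0")
    case False
    have "b\<^sup>2 * (norm x)\<^sup>2 \<le> (norm (blinfun_apply S x))\<^sup>2 + b\<^sup>2 * (norm x)\<^sup>2"
      by simp
    also have "\<dots> = Re (cinner (blinfun_apply Q x) x)"
      by (simp add: Q blinfun.add_left cinner_add_left cinner_scaleR_left Re_cinner_self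
          selfadjoint_opD [OF S, of "blinfun_apply S x"])
    also have "\<dots> \<le> norm (blinfun_apply Q x) * norm x"
      by (rule Re_cinner_le)
    finally show ?thesis
      using False by (simp add: power2_eq_square)
  qed simp
  with b show ?thesis
    unfolding bounded_below_def Q_def by (intro exI [of _ "b\<^sup>2"]) auto
qed

lemma map_poly_of_real_add:
  "map_poly complex_of_real (p + q) = map_poly of_real p + map_poly of_real q"
  by (rule poly_eqI) (simp add: coeff_map_poly)

lemma map_poly_of_real_mult:
  "map_poly complex_of_real (p * q) = map_poly of_real p * map_poly of_real q"
  by (rule poly_eqI) (simp add: coeff_map_poly coeff_mult)

lemma poly_map_poly_of_real: "poly (map_poly complex_of_real p) (of_real x) = of_real (poly p x)"
  by (induction p) (simp_all add: map_poly_pCons)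

text \<open>
  A complex root \<open>z\<close> gives the factor: for non-real \<open>z\<close>, the remainder modulo the real quadratic with
  roots \<open>z\<close> and its conjugate has degree at most 1 and vanishes at \<open>z\<close>, so it is zero.
\<close>

lemma real_poly_factor:
  fixes p :: "real poly"
  assumes "degree p > 0"
  obtains (linear) a q where "p = [:- a, 1:] * q"
    | (quadratic) a b q where "b \<noteq> 0" "p = [:a\<^sup>2 + b\<^sup>2, - 2 * a, 1:] * q"
proof -
  let ?C = "map_poly complex_of_real"
  have "\<not> constant (poly (?C p))"
    using assms by (simp add: constant_degree degree_map_poly)
  then obtain z where z: "poly (?C p) z = 0"
    using fundamental_theorem_of_algebra by blast
  show thesis
  proof (cases "Im z = 0")
    case True
    then have "z = of_real (Re z)"
      by (simp add: complex_eq_iff)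
    then have "poly p (Re z) = 0"
      using z poly_map_poly_of_real [of p "Re z"] by simp
    then show thesis
      using linear by (auto simp: poly_eq_0_iff_dvd)
  next
    case False
    define d where "d = [:(Re z)\<^sup>2 + (Im z)\<^sup>2, - 2 * Re z, 1:]"
    define r where "r = p mod d"
    have "d \<noteq> 0" "degree d = 2"
      by (simp_all add: d_def)
    then have "degree r < 2"
      using degree_mod_less' [of d p] by (cases "r = 0") (auto simp: r_def)
    then have "r = [:coeff r 0, coeff r 1:]"
      by (intro poly_eqI) (simp add: coeff_pCons coeff_eq_0 split: nat.split)
    then obtain u v where r: "r = [:u, v:]"
      by blast
    have "poly (?C d) z = 0"
      by (simp add: d_def map_poly_pCons complex_eq_iff power2_eq_square algebra_simps)
    moreover have "p = p div d * d + r"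
      by (simp add: r_def)
    then have "?C p = ?C (p div d) * ?C d + ?C r"
      by (metis map_poly_of_real_add map_poly_of_real_mult)
    ultimately have "poly (?C r) z = 0"
      using z by simp
    then have "u + Re z * v = 0" "Im z * v = 0"
      by (simp_all add: r map_poly_pCons complex_eq_iff)
    then have "r = 0"
      using False r by simp
    then have "p = d * (p div d)"
      by (simp add: r_def mod_eq_0_iff_dvd)
    then show thesis
      using False quadratic unfolding d_def by blast
  qed
qed

text \<open>
  Every irreducible real factor is bounded below: a linear one because its root is outside the
  spectrum, a quadratic one by self-adjointness.
\<close>

lemma bounded_below_poly_op:
  assumes T: "selfadjoint_op T"
    and "p \<noteq> 0" "\<And>t. t \<in> real_spectrum T \<Longrightarrow> poly p t \<noteq> 0"
  shows "bounded_below (poly_op p T)"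
  using assms(2,3)
proof (induction "degree p" arbitrary: p rule: less_induct)
  case less
  show ?case
  proof (cases "degree p = 0")
    case True
    then obtain a where a: "p = [:a:]"
      by (rule degree_eq_zeroE)
    with less.prems(1) show ?thesis
      by (auto simp: bounded_below_def poly_op_const intro!: exI [of _ "\<bar>a\<bar>"])
  next
    case False
    then have "degree p > 0"
      by simp
    then show ?thesis
    proof (cases rule: real_poly_factor)
      case (linear a q)
      with less.prems have "q \<noteq> 0"
        by auto
      then have "degree p = Suc (degree q)"
        unfolding linear by (subst degree_mult_eq) auto
      then have "bounded_below (poly_op q T)"
        using less.hyps [of q] less.prems(2) \<open>q \<noteq> 0\<close> by (simp add: linear)
      moreover have "a \<notin> real_spectrum T"
        using less.prems(2) [of a] by (auto simp: linear)
      then have "bounded_below (poly_op [:- a, 1:] T)"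
        using not_in_real_spectrum_iff [OF T] bounded_below_of_inverse
        by (auto simp: poly_op_linear scalar_op_def)
      ultimately show ?thesis
        unfolding linear poly_op_mult by (intro bounded_below_compose)
    next
      case (quadratic b a q)
      with less.prems have "q \<noteq> 0"
        by auto
      then have "degree p = Suc (Suc (degree q))"
        unfolding quadratic(2) by (subst degree_mult_eq) auto
      moreover have "poly q t \<noteq> 0" if "t \<in> real_spectrum T" for t
        using less.prems(2) [OF that] unfolding quadratic(2) poly_mult by simp
      ultimately have "bounded_below (poly_op q T)"
        using less.hyps [of q] \<open>q \<noteq> 0\<close> by simp
      then show ?thesis
        unfolding quadratic(2) poly_op_mult
        by (intro bounded_below_compose bounded_below_quadratic T quadratic(1))
    qed
  qed
qed

text \<open>
  If \<open>\<parallel>x\<parallel> = 1\<close> and \<open>\<parallel>S x\<parallel>\<close> is close to \<open>\<parallel>S\<parallel>\<close>, then \<open>(S\<^sup>2 - \<parallel>S\<parallel>\<^sup>2) x\<close> is small, since the square of its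
  norm is at most \<open>\<parallel>S\<parallel>\<^sup>2 (\<parallel>S\<parallel>\<^sup>2 - \<parallel>S x\<parallel>\<^sup>2)\<close>.
\<close>

lemma norm_attained_approximately:
  fixes S :: "'a::complex_hilbert_space \<Rightarrow>\<^sub>L 'a"
  assumes S: "selfadjoint_op S" and nz: "\<exists>x::'a. x \<noteq> 0"
  shows "\<not> bounded_below ((S o\<^sub>L S) - scalar_op ((norm S)\<^sup>2))"
proof
  define N where "N = norm S"
  assume "bounded_below ((S o\<^sub>L S) - scalar_op ((norm S)\<^sup>2))"
  then obtain c where c: "c > 0"
    "\<And>x. c * norm x \<le> norm (blinfun_apply S (blinfun_apply S x) - N\<^sup>2 *\<^sub>R x)"
    by (auto simp: bounded_below_def blinfun.diff_left N_def)
  have key: "c\<^sup>2 * (norm x)\<^sup>2 \<le> N\<^sup>2 * (N\<^sup>2 * (norm x)\<^sup>2 - (norm (blinfun_apply S x))\<^sup>2)" for x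
  proof -
    have "(norm (blinfun_apply S (blinfun_apply S x)))\<^sup>2 \<le> (N * norm (blinfun_apply S x))\<^sup>2"
      unfolding N_def by (intro power_mono norm_blinfun) auto
    moreover have "(norm (blinfun_apply S (blinfun_apply S x) - N\<^sup>2 *\<^sub>R x))\<^sup>2
        = (norm (blinfun_apply S (blinfun_apply S x)))\<^sup>2
          - 2 * (N\<^sup>2 * (norm (blinfun_apply S x))\<^sup>2) + N\<^sup>2 * (N\<^sup>2 * (norm x)\<^sup>2)"
      by (simp add: norm_diff_square cinner_scaleR_right Re_cinner_self power_mult_distrib
          selfadjoint_opD [OF S, of "blinfun_apply S x"])
    moreover have "(c * norm x)\<^sup>2
        \<le> (norm (blinfun_apply S (blinfun_apply S x) - N\<^sup>2 *\<^sub>R x))\<^sup>2"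
      using c by (intro power_mono) auto
    ultimately show ?thesis
      by (simp add: power_mult_distrib algebra_simps)
  qed
  obtain x0 :: 'a where x0: "x0 \<noteq> 0"
    using nz by blast
  have "N \<noteq> 0"
    using key [of x0] x0 c(1) by (auto simp: mult_le_0_iff)
  then have N: "N > 0"
    by (simp add: N_def)
  define q where "q = N\<^sup>2 - c\<^sup>2 / N\<^sup>2"
  have le: "(norm (blinfun_apply S x))\<^sup>2 \<le> q * (norm x)\<^sup>2" for x
    using key [of x] N by (simp add: q_def field_simps)
  have "0 \<le> q * (norm x0)\<^sup>2"
    using le [of x0] order_trans zero_le_power2 by blast
  then have q: "0 \<le> q"
    using x0 by (simp add: zero_le_mult_iff)
  have "norm (blinfun_apply S x) \<le> sqrt q * norm x" for x
    using real_sqrt_le_mono [OF le [of x]] by (simp add: real_sqrt_mult)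
  then have "N \<le> sqrt q"
    unfolding N_def using q by (intro norm_blinfun_bound) auto
  then have "N\<^sup>2 \<le> q"
    using N q by (metis less_imp_le power_mono real_sqrt_pow2)
  then show False
    using N c(1) by (simp add: q_def divide_le_0_iff)
qed

text \<open>
  If \<open>M < \<parallel>p(T)\<parallel>\<close>, then \<open>p\<^sup>2 - \<parallel>p(T)\<parallel>\<^sup>2\<close> has no root on the spectrum, so \<open>p(T)\<^sup>2 - \<parallel>p(T)\<parallel>\<^sup>2\<close> is
  bounded below, which is impossible. The same argument with \<open>p(t) = t\<close> shows that the
  spectrum is nonempty, which excludes that \<open>p\<^sup>2 - \<parallel>p(T)\<parallel>\<^sup>2\<close> is the zero polynomial.
\<close>

lemma norm_poly_op_le:
  fixes T :: "'a::complex_hilbert_space \<Rightarrow>\<^sub>L 'a"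
  assumes T: "selfadjoint_op T" and M: "0 \<le> M"
    and bound: "\<And>t. t \<in> real_spectrum T \<Longrightarrow> \<bar>poly p t\<bar> \<le> M"
  shows "norm (poly_op p T) \<le> M"
proof (rule ccontr)
  assume "\<not> norm (poly_op p T) \<le> M"
  then have less: "M < norm (poly_op p T)"
    by simp
  have nz: "\<exists>x::'a. x \<noteq> 0"
  proof (rule ccontr)
    assume "\<not> (\<exists>x::'a. x \<noteq> 0)"
    then have "poly_op p T = 0"
      by (intro blinfun_eqI) simp
    with less M show False
      by simp
  qed
  have attained: "q * q = [:(norm (poly_op q T))\<^sup>2:]"
    if "\<And>t. t \<in> real_spectrum T \<Longrightarrow> poly q t * poly q t \<noteq> (norm (poly_op q T))\<^sup>2" for q
  proof (rule ccontr)
    assume "q * q \<noteq> [:(norm (poly_op q T))\<^sup>2:]"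
    then have "bounded_below (poly_op (q * q - [:(norm (poly_op q T))\<^sup>2:]) T)"
      using that by (intro bounded_below_poly_op [OF T]) auto
    then show False
      using norm_attained_approximately [OF selfadjoint_poly_op [OF T] nz]
      by (simp add: poly_op_diff poly_op_mult poly_op_const)
  qed
  have "real_spectrum T \<noteq> {}"
    using attained [of "[:0, 1:]"] by auto
  have sq_less: "poly p t * poly p t < (norm (poly_op p T))\<^sup>2" if "t \<in> real_spectrum T" for t
  proof -
    have "\<bar>poly p t\<bar>\<^sup>2 < (norm (poly_op p T))\<^sup>2"
      using bound [OF that] less by (intro power_strict_mono) auto
    then show ?thesis
      by (simp add: power2_eq_square)
  qed
  obtain t where t: "t \<in> real_spectrum T"
    using \<open>real_spectrum T \<noteq> {}\<close> by blast
  have "p * p = [:(norm (poly_op p T))\<^sup>2:]"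
    using sq_less by (intro attained) force
  then have "poly p t * poly p t = (norm (poly_op p T))\<^sup>2"
    by (metis mult_zero_right add_0_right poly_0 poly_mult poly_pCons)
  with sq_less [OF t] show False
    by simp
qed

section \<open>The continuous functional calculus\<close>

lemma poly_op_tendsto_0:
  assumes "selfadjoint_op T"
    and lim: "uniform_limit (real_spectrum T) (\<lambda>n t. poly (p n) t) (\<lambda>t. 0) sequentially"
  shows "(\<lambda>n. poly_op (p n) T) \<longlonglongrightarrow> 0"
proof (rule tendstoI)
  fix e :: real
  assume e: "e > 0"
  then have "\<forall>\<^sub>F n in sequentially. \<forall>t \<in> real_spectrum T. dist (poly (p n) t) 0 < e / 2"
    using uniform_limitD [OF lim] half_gt_zero by blast
  then show "\<forall>\<^sub>F n in sequentially. dist (poly_op (p n) T) 0 < e"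
  proof eventually_elim
    case (elim n)
    then have "norm (poly_op (p n) T) \<le> e / 2"
      using e by (intro norm_poly_op_le assms(1)) (auto simp: dist_norm less_imp_le)
    then show ?case
      using e by simp
  qed
qed

lemma poly_op_convergent:
  assumes "selfadjoint_op T"
    and lim: "uniform_limit (real_spectrum T) (\<lambda>n t. poly (p n) t) f sequentially"
  shows "convergent (\<lambda>n. poly_op (p n) T)"
proof (rule Cauchy_convergent, rule CauchyI)
  fix e :: real
  assume e: "e > 0"
  then obtain N where N: "\<And>n t. n \<ge> N \<Longrightarrow> t \<in> real_spectrum T \<Longrightarrow> dist (poly (p n) t) (f t) < e / 4"
    using uniform_limitD [OF lim, of "e / 4"] unfolding eventually_sequentially by auto
  have "norm (poly_op (p m) T - poly_op (p n) T) < e" if "m \<ge> N" "n \<ge> N" for m n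
  proof -
    have "\<bar>poly (p m - p n) t\<bar> \<le> e / 2" if "t \<in> real_spectrum T" for t
      using N [OF \<open>m \<ge> N\<close> that] N [OF \<open>n \<ge> N\<close> that] unfolding dist_real_def poly_diff
      by linarith
    then have "norm (poly_op (p m - p n) T) \<le> e / 2"
      using e by (intro norm_poly_op_le assms(1)) auto
    then show ?thesis
      using e by (simp add: poly_op_diff)
  qed
  then show "\<exists>N. \<forall>m\<ge>N. \<forall>n\<ge>N. norm (poly_op (p m) T - poly_op (p n) T) < e"
    by blast
qed

lemma cfc_eqI:
  assumes T: "selfadjoint_op T"
    and lim: "uniform_limit (real_spectrum T) (\<lambda>n t. poly (p n) t) f sequentially"
    and S: "(\<lambda>n. poly_op (p n) T) \<longlonglongrightarrow> S"
  shows "cfc f T = S"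
  unfolding cfc_def real_spectrum_def [symmetric]
proof (rule the_equality)
  show "\<exists>p. uniform_limit (real_spectrum T) (\<lambda>n t. poly (p n) t) f sequentially
      \<and> (\<lambda>n. poly_op (p n) T) \<longlonglongrightarrow> S"
    using lim S by blast
  fix S'
  assume "\<exists>p. uniform_limit (real_spectrum T) (\<lambda>n t. poly (p n) t) f sequentially
      \<and> (\<lambda>n. poly_op (p n) T) \<longlonglongrightarrow> S'"
  then obtain q where q: "uniform_limit (real_spectrum T) (\<lambda>n t. poly (q n) t) f sequentially"
    "(\<lambda>n. poly_op (q n) T) \<longlonglongrightarrow> S'"
    by blast
  have "(\<lambda>n. poly_op (q n - p n) T) \<longlonglongrightarrow> 0"
    using uniform_limit_minus [OF q(1) lim] by (intro poly_op_tendsto_0 [OF T]) simp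
  moreover have "(\<lambda>n. poly_op (q n - p n) T) \<longlonglongrightarrow> S' - S"
    unfolding poly_op_diff by (intro tendsto_diff q(2) S)
  ultimately show "S' = S"
    using LIMSEQ_unique by fastforce
qed

lemma polynomial_uniform_approximation:
  fixes f :: "real \<Rightarrow> real"
  assumes "compact K" "continuous_on K f"
  obtains p where "uniform_limit K (\<lambda>n t. poly (p n) t) f sequentially"
proof -
  have "\<exists>p. \<forall>t\<in>K. \<bar>f t - poly p t\<bar> < 1 / Suc n" for n
  proof -
    obtain g where g: "real_polynomial_function g" "\<And>t. t \<in> K \<Longrightarrow> \<bar>f t - g t\<bar> < 1 / Suc n"
      using Stone_Weierstrass_real_polynomial_function [OF assms, of "1 / Suc n"] by auto
    then obtain a m where "g = (\<lambda>t. \<Sum>i\<le>m. a i * t ^ i)"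
      by (auto simp: real_polynomial_function_iff_sum)
    then have "g t = poly (\<Sum>i\<le>m. monom (a i) i) t" for t
      by (simp add: poly_sum poly_monom)
    with g(2) show ?thesis
      by metis
  qed
  then obtain p where p: "\<And>n t. t \<in> K \<Longrightarrow> \<bar>f t - poly (p n) t\<bar> < 1 / Suc n"
    by metis
  have "uniform_limit K (\<lambda>n t. poly (p n) t) f sequentially"
  proof (rule uniform_limitI)
    fix e :: real
    assume "e > 0"
    then have "\<forall>\<^sub>F n in sequentially. 1 / Suc n < e"
      using order_tendstoD(2) [OF LIMSEQ_inverse_real_of_nat] by (simp add: inverse_eq_divide)
    then show "\<forall>\<^sub>F n in sequentially. \<forall>t\<in>K. dist (poly (p n) t) (f t) < e"
    proof eventually_elim
      case (elim n)
      then show ?case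
        using p [of _ n] by (fastforce simp: dist_real_def abs_minus_commute)
    qed
  qed
  then show thesis
    by (rule that)
qed

lemma cfc_approximation:
  assumes "selfadjoint_op T" "continuous_on (real_spectrum T) f"
  obtains p where "uniform_limit (real_spectrum T) (\<lambda>n t. poly (p n) t) f sequentially"
    and "(\<lambda>n. poly_op (p n) T) \<longlonglongrightarrow> cfc f T"
proof -
  obtain p where p: "uniform_limit (real_spectrum T) (\<lambda>n t. poly (p n) t) f sequentially"
    using polynomial_uniform_approximation [OF compact_real_spectrum] assms by blast
  then obtain S where "(\<lambda>n. poly_op (p n) T) \<longlonglongrightarrow> S"
    using poly_op_convergent [OF assms(1) p] by (auto simp: convergent_def)
  with p show thesis
    using that cfc_eqI [OF assms(1) p] by simp
qed

lemma cfc_cong: "(\<And>t. t \<in> real_spectrum T \<Longrightarrow> f t = g t) \<Longrightarrow> cfc f T = cfc g T"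
  unfolding cfc_def real_spectrum_def [symmetric] by (simp cong: uniform_limit_cong')

lemma selfadjoint_cfc:
  assumes T: "selfadjoint_op T" and f: "continuous_on (real_spectrum T) f"
  shows "selfadjoint_op (cfc f T)"
  using cfc_approximation [OF assms] selfadjoint_op_limit selfadjoint_poly_op [OF T] by metis

lemma cfc_poly: "selfadjoint_op T \<Longrightarrow> cfc (poly p) T = poly_op p T"
  by (rule cfc_eqI [where p = "\<lambda>_. p"]) (auto intro: uniform_limit_const)

lemma cfc_const: "selfadjoint_op T \<Longrightarrow> cfc (\<lambda>t. c) T = scalar_op c"
  using cfc_poly [of T "[:c:]"] cfc_cong [of T "\<lambda>t. c" "poly [:c:]"] by (simp add: poly_op_const)

lemma cfc_ident: "selfadjoint_op T \<Longrightarrow> cfc (\<lambda>t. t) T = T"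
  using cfc_poly [of T "[:0, 1:]"] cfc_cong [of T "\<lambda>t. t" "poly [:0, 1:]"]
  by (simp add: poly_op_linear scalar_op_def)

lemma cfc_add:
  assumes T: "selfadjoint_op T"
    and f: "continuous_on (real_spectrum T) f" and g: "continuous_on (real_spectrum T) g"
  shows "cfc (\<lambda>t. f t + g t) T = cfc f T + cfc g T"
proof -
  obtain p q where "uniform_limit (real_spectrum T) (\<lambda>n t. poly (p n) t) f sequentially"
    "(\<lambda>n. poly_op (p n) T) \<longlonglongrightarrow> cfc f T"
    "uniform_limit (real_spectrum T) (\<lambda>n t. poly (q n) t) g sequentially"
    "(\<lambda>n. poly_op (q n) T) \<longlonglongrightarrow> cfc g T"
    using cfc_approximation [OF T f] cfc_approximation [OF T g] by metis
  then show ?thesis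
    by (intro cfc_eqI [OF T, where p = "\<lambda>n. p n + q n"])
      (auto simp: poly_op_add intro: uniform_limit_add tendsto_add)
qed

lemma cfc_mult:
  assumes T: "selfadjoint_op T"
    and f: "continuous_on (real_spectrum T) f" and g: "continuous_on (real_spectrum T) g"
  shows "cfc (\<lambda>t. f t * g t) T = (cfc f T o\<^sub>L cfc g T)"
proof -
  obtain p q where p: "uniform_limit (real_spectrum T) (\<lambda>n t. poly (p n) t) f sequentially"
    "(\<lambda>n. poly_op (p n) T) \<longlonglongrightarrow> cfc f T"
    and q: "uniform_limit (real_spectrum T) (\<lambda>n t. poly (q n) t) g sequentially"
    "(\<lambda>n. poly_op (q n) T) \<longlonglongrightarrow> cfc g T"
    using cfc_approximation [OF T f] cfc_approximation [OF T g] by metis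
  have "bounded (f ` real_spectrum T)" "bounded (g ` real_spectrum T)"
    using compact_real_spectrum [OF T] f g
    by (auto intro: compact_imp_bounded compact_continuous_image)
  with p q show ?thesis
    by (intro cfc_eqI [OF T, where p = "\<lambda>n. p n * q n"])
      (auto simp: poly_op_mult
        intro: bounded_bilinear.bounded_uniform_limit [OF bounded_bilinear_mult]
          bounded_bilinear.tendsto [OF bounded_bilinear_blinfun_compose])
qed

lemma cfc_diff:
  assumes T: "selfadjoint_op T"
    and f: "continuous_on (real_spectrum T) f" and g: "continuous_on (real_spectrum T) g"
  shows "cfc (\<lambda>t. f t - g t) T = cfc f T - cfc g T"
  using cfc_add [OF T continuous_on_diff [OF f g] g] by (simp add: algebra_simps)

lemma norm_cfc_le:
  assumes T: "selfadjoint_op T" and f: "continuous_on (real_spectrum T) f" and M: "0 \<le> M"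
    and bound: "\<And>t. t \<in> real_spectrum T \<Longrightarrow> \<bar>f t\<bar> \<le> M"
  shows "norm (cfc f T) \<le> M"
proof (rule field_le_epsilon)
  fix e :: real
  assume e: "e > 0"
  obtain p where p: "uniform_limit (real_spectrum T) (\<lambda>n t. poly (p n) t) f sequentially"
    "(\<lambda>n. poly_op (p n) T) \<longlonglongrightarrow> cfc f T"
    using cfc_approximation [OF T f] .
  show "norm (cfc f T) \<le> M + e"
  proof (rule tendsto_upperbound [OF tendsto_norm [OF p(2)]])
    show "\<forall>\<^sub>F n in sequentially. norm (poly_op (p n) T) \<le> M + e"
      using uniform_limitD [OF p(1) e]
    proof eventually_elim
      case (elim n)
      have "\<bar>poly (p n) t\<bar> \<le> M + e" if "t \<in> real_spectrum T" for t
        using elim that bound [OF that] by (fastforce simp: dist_real_def)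
      then show ?case
        using e M by (intro norm_poly_op_le [OF T]) auto
    qed
  qed simp
qed

lemma cfc_mono:
  assumes T: "selfadjoint_op T"
    and f: "continuous_on (real_spectrum T) f" and g: "continuous_on (real_spectrum T) g"
    and le: "\<And>t. t \<in> real_spectrum T \<Longrightarrow> f t \<le> g t"
  shows "cfc g T \<ge>\<^sub>o\<^sub>p cfc f T"
  unfolding op_ge_def
proof (intro conjI allI selfadjoint_cfc T f g)
  fix x
  define h where "h t = g t - f t" for t
  have h: "continuous_on (real_spectrum T) h"
    unfolding h_def by (intro continuous_intros f g)
  then have "bounded (h ` real_spectrum T)"
    using compact_real_spectrum [OF T] by (auto intro: compact_imp_bounded compact_continuous_image)
  then obtain M where M: "0 \<le> M" "\<And>t. t \<in> real_spectrum T \<Longrightarrow> h t \<le> M"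
    unfolding bounded_pos by (metis abs_ge_self image_eqI less_imp_le order_trans real_norm_def)
  \<comment> \<open>The values of \<open>M - h\<close> lie between 0 and \<open>M\<close>, so \<open>M - h(T)\<close> has norm at most \<open>M\<close>.\<close>
  have "norm (cfc (\<lambda>t. M - h t) T) \<le> M"
    using M le h by (intro norm_cfc_le T) (auto simp: h_def intro!: continuous_intros)
  then have "norm (scalar_op M - cfc h T) \<le> M"
    by (simp add: cfc_diff [OF T continuous_on_const h] cfc_const [OF T])
  then have "norm (blinfun_apply (scalar_op M - cfc h T) x) \<le> M * norm x"
    using norm_blinfun order_trans mult_right_mono norm_ge_zero by metis
  then have "norm (blinfun_apply (scalar_op M - cfc h T) x) * norm x \<le> M * norm x * norm x"
    by (simp add: mult_right_mono)
  then have "Re (cinner (blinfun_apply (scalar_op M - cfc h T) x) x) \<le> M * norm x * norm x"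
    using Re_cinner_le order_trans by blast
  then have "0 \<le> Re (cinner (blinfun_apply (cfc h T) x) x)"
    by (simp add: blinfun.diff_left cinner.diff_left cinner_scaleR_left Re_cinner_self
        power2_eq_square)
  moreover have "cfc h T = cfc g T - cfc f T"
    unfolding h_def by (rule cfc_diff [OF T g f])
  ultimately show "Re (cinner (blinfun_apply (cfc f T) x) x)
      \<le> Re (cinner (blinfun_apply (cfc g T) x) x)"
    by (simp add: blinfun.diff_left cinner.diff_left)
qed

lemma cfc_uniform_limit:
  assumes T: "selfadjoint_op T" and f: "\<And>n. continuous_on (real_spectrum T) (f n)"
    and lim: "uniform_limit (real_spectrum T) f g sequentially"
  shows "(\<lambda>n. cfc (f n) T) \<longlonglongrightarrow> cfc g T"
proof (rule tendstoI)
  fix e :: real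
  assume e: "e > 0"
  have g: "continuous_on (real_spectrum T) g"
    using uniform_limit_theorem [OF _ lim] f by simp
  have "\<forall>\<^sub>F n in sequentially. \<forall>t \<in> real_spectrum T. dist (f n t) (g t) < e / 2"
    using uniform_limitD [OF lim] e half_gt_zero by blast
  then show "\<forall>\<^sub>F n in sequentially. dist (cfc (f n) T) (cfc g T) < e"
  proof eventually_elim
    case (elim n)
    then have "norm (cfc (\<lambda>t. f n t - g t) T) \<le> e / 2"
      using e by (intro norm_cfc_le T continuous_on_diff f g) (auto simp: dist_real_def less_imp_le)
    then show ?case
      using e by (simp add: cfc_diff [OF T f g] dist_norm)
  qed
qed

lemma inverse_of_cfc:
  assumes T: "selfadjoint_op T" and f: "continuous_on (real_spectrum T) f"
    and nz: "\<And>t. t \<in> real_spectrum T \<Longrightarrow> f t \<noteq> 0"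
  shows "inverse_of (cfc (\<lambda>t. inverse (f t)) T) (cfc f T)"
proof -
  have f': "continuous_on (real_spectrum T) (\<lambda>t. inverse (f t))"
    using f nz by (intro continuous_intros) auto
  have "cfc (\<lambda>t. inverse (f t) * f t) T = cfc (\<lambda>t. 1) T"
    "cfc (\<lambda>t. f t * inverse (f t)) T = cfc (\<lambda>t. 1) T"
    using nz by (auto intro!: cfc_cong)
  then show ?thesis
    by (simp add: inverse_of_def cfc_mult T f f' cfc_const scalar_op_def)
qed

section \<open>Monotonicity of powers\<close>

text \<open>
  The form of a positive \<open>T\<close> with inverse \<open>T'\<close> satisfies
  \<open>\<langle>T' x, x\<rangle> \<ge> 2 Re \<langle>x, y\<rangle> - \<langle>T y, y\<rangle>\<close> for every \<open>y\<close>; for \<open>y = S' x\<close> and \<open>T \<le> S\<close> the right-hand side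
  is at least \<open>\<langle>S' x, x\<rangle>\<close>.
\<close>

lemma op_ge_inverse_antimono:
  assumes ST: "S \<ge>\<^sub>o\<^sub>p T" and T: "T \<ge>\<^sub>o\<^sub>p 0" and S': "inverse_of S' S" and T': "inverse_of T' T"
  shows "T' \<ge>\<^sub>o\<^sub>p S'"
proof -
  have sa: "selfadjoint_op S" "selfadjoint_op T" "selfadjoint_op S'" "selfadjoint_op T'"
    using ST S' T' selfadjoint_op_inverse by (auto simp: op_ge_def)
  have "Re (cinner (blinfun_apply S' x) x) \<le> Re (cinner (blinfun_apply T' x) x)" for x
  proof -
    define y where "y = blinfun_apply S' x"
    define z where "z = blinfun_apply T' x"
    have Sy: "blinfun_apply S y = x" and Tz: "blinfun_apply T z = x"
      by (simp_all add: y_def z_def inverse_of_apply [OF S'] inverse_of_apply [OF T'])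
    have "0 \<le> Re (cinner (blinfun_apply T (z - y)) (z - y))"
      using op_geD [OF T, of "z - y"] by (simp add: cinner.zero_left)
    also have "\<dots> = Re (cinner z x) - 2 * Re (cinner y x) + Re (cinner (blinfun_apply T y) y)"
      using selfadjoint_opD [OF sa(2), of y z]
      by (simp add: blinfun.diff_right cinner.diff_left cinner.diff_right Tz
          Re_cinner_commute [of x])
    also have "Re (cinner (blinfun_apply T y) y) \<le> Re (cinner y x)"
      using op_geD [OF ST, of y] by (simp add: Sy Re_cinner_commute [of x])
    finally show ?thesis
      by (simp add: y_def z_def)
  qed
  then show ?thesis
    using sa by (simp add: op_ge_def)
qed

text \<open>
  Continuity and positivity on the spectra are included because \<open>f(X)\<close> and \<open>g(Y)\<close> must be positive
  and invertible for the step to harmonic means. Inversion exchanges the roles of \<open>(X, f)\<close> and \<open>(Y, g)\<close>.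
\<close>

definition dominates ::
  "('a::complex_hilbert_space \<Rightarrow>\<^sub>L 'a) \<Rightarrow> ('a \<Rightarrow>\<^sub>L 'a) \<Rightarrow> (real \<Rightarrow> real) \<Rightarrow> (real \<Rightarrow> real) \<Rightarrow> bool" where
  "dominates X Y f g \<longleftrightarrow>
    selfadjoint_op X \<and> continuous_on (real_spectrum X) f \<and> (\<forall>t \<in> real_spectrum X. 0 < f t) \<and>
    selfadjoint_op Y \<and> continuous_on (real_spectrum Y) g \<and> (\<forall>t \<in> real_spectrum Y. 0 < g t) \<and>
    cfc f X \<ge>\<^sub>o\<^sub>p cfc g Y"

lemma dominates_cong:
  assumes "dominates X Y f g" "\<And>t. t \<in> real_spectrum X \<Longrightarrow> f t = f' t"
    and "\<And>t. t \<in> real_spectrum Y \<Longrightarrow> g t = g' t"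
  shows "dominates X Y f' g'"
  using assms cfc_cong [of X f f'] cfc_cong [of Y g g']
  unfolding dominates_def by (simp cong: continuous_on_cong)

lemma dominates_one:
  assumes "selfadjoint_op X" "selfadjoint_op Y"
  shows "dominates X Y (\<lambda>t. 1) (\<lambda>t. 1)"
  using assms by (simp add: dominates_def cfc_const op_ge_def selfadjoint_op_scalar)

lemma op_ge_mean:
  assumes "S \<ge>\<^sub>o\<^sub>p T" "S' \<ge>\<^sub>o\<^sub>p T'"
  shows "(1/2) *\<^sub>R (S + S') \<ge>\<^sub>o\<^sub>p (1/2) *\<^sub>R (T + T')"
  using assms unfolding op_ge_def
  by (auto intro!: selfadjoint_op_scaleR selfadjoint_op_add add_mono
      simp: blinfun.scaleR_left blinfun.add_left cinner_scaleR_left cinner_add_left)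

lemma cfc_mean:
  assumes T: "selfadjoint_op T"
    and f: "continuous_on (real_spectrum T) f" and g: "continuous_on (real_spectrum T) g"
  shows "cfc (\<lambda>t. (f t + g t) / 2) T = (1/2) *\<^sub>R (cfc f T + cfc g T)"
proof -
  have "cfc (\<lambda>t. (1/2) * (f t + g t)) T = (1/2) *\<^sub>R (cfc f T + cfc g T)"
    using cfc_mult [OF T continuous_on_const continuous_on_add [OF f g], of "1/2"]
    by (auto intro!: blinfun_eqI
        simp: cfc_const [OF T] cfc_add [OF T f g] blinfun.scaleR_left)
  then show ?thesis
    by simp
qed

lemma dominates_arithmetic_mean:
  assumes "dominates X Y f g" "dominates X Y f' g'"
  shows "dominates X Y (\<lambda>t. (f t + f' t) / 2) (\<lambda>t. (g t + g' t) / 2)"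
  using assms unfolding dominates_def
  by (auto simp: cfc_mean op_ge_mean add_pos_pos intro!: continuous_intros)

lemma dominates_inverse:
  assumes "dominates X Y f g"
  shows "dominates Y X (\<lambda>t. inverse (g t)) (\<lambda>t. inverse (f t))"
proof -
  have X: "selfadjoint_op X" "continuous_on (real_spectrum X) f" "\<And>t. t \<in> real_spectrum X \<Longrightarrow> 0 < f t"
    and Y: "selfadjoint_op Y" "continuous_on (real_spectrum Y) g" "\<And>t. t \<in> real_spectrum Y \<Longrightarrow> 0 < g t"
    and ge: "cfc f X \<ge>\<^sub>o\<^sub>p cfc g Y"
    using assms by (auto simp: dominates_def)
  have "cfc g Y \<ge>\<^sub>o\<^sub>p cfc (\<lambda>t. 0) Y"
    using Y by (intro cfc_mono) (auto simp: less_imp_le)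
  then have "cfc g Y \<ge>\<^sub>o\<^sub>p 0"
    by (simp add: cfc_const [OF Y(1)] scalar_op_def)
  moreover have "inverse_of (cfc (\<lambda>t. inverse (f t)) X) (cfc f X)"
    "inverse_of (cfc (\<lambda>t. inverse (g t)) Y) (cfc g Y)"
    using inverse_of_cfc [OF X(1,2)] inverse_of_cfc [OF Y(1,2)] X(3) Y(3) by force+
  ultimately have "cfc (\<lambda>t. inverse (g t)) Y \<ge>\<^sub>o\<^sub>p cfc (\<lambda>t. inverse (f t)) X"
    by (rule op_ge_inverse_antimono [OF ge])
  then show ?thesis
    using continuous_on_inverse [OF X(2)] continuous_on_inverse [OF Y(2)] X Y
    unfolding dominates_def by force
qed

lemma dominates_harmonic_mean:
  assumes "dominates X Y f g" "dominates X Y f' g'"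
  shows "dominates X Y (\<lambda>t. inverse ((inverse (f t) + inverse (f' t)) / 2))
    (\<lambda>t. inverse ((inverse (g t) + inverse (g' t)) / 2))"
  by (intro dominates_inverse dominates_arithmetic_mean assms)

text \<open>
  Replacing two numbers by their arithmetic and harmonic means keeps their product and at least
  halves their distance, so the iteration approaches their geometric mean.
\<close>

fun mean_iteration :: "nat \<Rightarrow> real \<Rightarrow> real \<Rightarrow> real" where
  "mean_iteration 0 a b = a"
| "mean_iteration (Suc n) a b
    = mean_iteration n ((a + b) / 2) (inverse ((inverse a + inverse b) / 2))"

lemma mean_iteration_error:
  assumes "a > 0" "b > 0"
  shows "\<bar>mean_iteration n a b - sqrt (a * b)\<bar> \<le> \<bar>a - b\<bar> * (1 / 2) ^ n"
  using assms
proof (induction n arbitrary: a b)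
  case 0
  have "min a b \<le> sqrt (a * b)"
    using 0 by (intro real_le_rsqrt) (auto simp: power2_eq_square intro!: mult_mono)
  moreover have "sqrt (a * b) \<le> max a b"
    using 0 by (intro real_le_lsqrt) (auto simp: power2_eq_square intro!: mult_mono)
  ultimately show ?case
    by auto
next
  case (Suc n)
  define h where "h = inverse ((inverse a + inverse b) / 2)"
  have h: "h = 2 * a * b / (a + b)" "h > 0"
    using Suc.prems by (simp_all add: h_def field_simps add_pos_pos)
  have prod: "(a + b) / 2 * h = a * b"
    using Suc.prems by (simp add: h(1) add_pos_pos)
  have "\<bar>(a + b) / 2 - h\<bar> \<le> \<bar>a - b\<bar> / 2"
  proof -
    have "(a + b) / 2 - h = (a - b) * (a - b) / (2 * (a + b))"
      using Suc.prems by (simp add: h(1) field_simps add_pos_pos)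
    also have "\<bar>\<dots>\<bar> = \<bar>a - b\<bar> * (\<bar>a - b\<bar> / (a + b)) / 2"
      using Suc.prems by (simp add: abs_mult)
    also have "\<dots> \<le> \<bar>a - b\<bar> * 1 / 2"
      using Suc.prems by (intro divide_right_mono mult_left_mono) (auto simp: pos_divide_le_eq)
    finally show ?thesis
      by simp
  qed
  then have "\<bar>(a + b) / 2 - h\<bar> * (1 / 2) ^ n \<le> \<bar>a - b\<bar> / 2 * (1 / 2) ^ n"
    by (rule mult_right_mono) simp
  moreover have "\<bar>mean_iteration n ((a + b) / 2) h - sqrt (a * b)\<bar>
      \<le> \<bar>(a + b) / 2 - h\<bar> * (1 / 2) ^ n"
    using Suc.IH [of "(a + b) / 2" h, unfolded prod] Suc.prems h(2) by simp
  ultimately have "\<bar>mean_iteration n ((a + b) / 2) h - sqrt (a * b)\<bar> \<le> \<bar>a - b\<bar> / 2 * (1 / 2) ^ n"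
    by (rule order_trans [rotated])
  then show ?case
    by (simp add: h_def)
qed

lemma mean_iteration_uniform_limit:
  fixes f g :: "real \<Rightarrow> real"
  assumes K: "compact K" and f: "continuous_on K f" and g: "continuous_on K g"
    and pos: "\<And>t. t \<in> K \<Longrightarrow> 0 < f t" "\<And>t. t \<in> K \<Longrightarrow> 0 < g t"
  shows "uniform_limit K (\<lambda>n t. mean_iteration n (f t) (g t)) (\<lambda>t. sqrt (f t * g t)) sequentially"
proof (rule uniform_limitI)
  fix e :: real
  assume e: "e > 0"
  have "bounded ((\<lambda>t. f t - g t) ` K)"
    using K f g by (intro compact_imp_bounded compact_continuous_image continuous_intros)
  then obtain C where C: "\<And>t. t \<in> K \<Longrightarrow> \<bar>f t - g t\<bar> \<le> C"
    by (auto simp: bounded_iff)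
  have "(\<lambda>n. C * (1 / 2) ^ n) \<longlonglongrightarrow> C * 0"
    by (intro tendsto_mult tendsto_const LIMSEQ_realpow_zero) auto
  then have "\<forall>\<^sub>F n in sequentially. C * (1 / 2) ^ n < e"
    using e by (intro order_tendstoD(2) [where y = "C * 0"]) auto
  then show "\<forall>\<^sub>F n in sequentially. \<forall>t\<in>K.
      dist (mean_iteration n (f t) (g t)) (sqrt (f t * g t)) < e"
  proof eventually_elim
    case (elim n)
    show ?case
    proof
      fix t assume t: "t \<in> K"
      have "\<bar>mean_iteration n (f t) (g t) - sqrt (f t * g t)\<bar> \<le> \<bar>f t - g t\<bar> * (1 / 2) ^ n"
        using pos t by (intro mean_iteration_error) auto
      also have "\<dots> \<le> C * (1 / 2) ^ n"
        using C [OF t] by (intro mult_right_mono) auto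
      finally show "dist (mean_iteration n (f t) (g t)) (sqrt (f t * g t)) < e"
        using elim by (simp add: dist_real_def)
    qed
  qed
qed

lemma dominates_mean_iteration:
  assumes "dominates X Y f g" "dominates X Y f' g'"
  shows "dominates X Y (\<lambda>t. mean_iteration n (f t) (f' t)) (\<lambda>t. mean_iteration n (g t) (g' t))"
  using assms
proof (induction n arbitrary: f g f' g')
  case (Suc n)
  show ?case
    using Suc.IH [OF dominates_arithmetic_mean dominates_harmonic_mean, OF Suc.prems Suc.prems]
    by simp
qed simp

lemma dominates_geometric_mean:
  assumes fg: "dominates X Y f g" and fg': "dominates X Y f' g'"
  shows "dominates X Y (\<lambda>t. sqrt (f t * f' t)) (\<lambda>t. sqrt (g t * g' t))"
proof -
  have X: "selfadjoint_op X" "continuous_on (real_spectrum X) f" "continuous_on (real_spectrum X) f'"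
      "\<And>t. t \<in> real_spectrum X \<Longrightarrow> 0 < f t" "\<And>t. t \<in> real_spectrum X \<Longrightarrow> 0 < f' t"
    and Y: "selfadjoint_op Y" "continuous_on (real_spectrum Y) g" "continuous_on (real_spectrum Y) g'"
      "\<And>t. t \<in> real_spectrum Y \<Longrightarrow> 0 < g t" "\<And>t. t \<in> real_spectrum Y \<Longrightarrow> 0 < g' t"
    using assms by (auto simp: dominates_def)
  have it: "dominates X Y (\<lambda>t. mean_iteration n (f t) (f' t)) (\<lambda>t. mean_iteration n (g t) (g' t))" for n
    by (rule dominates_mean_iteration [OF fg fg'])
  have "cfc (\<lambda>t. sqrt (f t * f' t)) X \<ge>\<^sub>o\<^sub>p cfc (\<lambda>t. sqrt (g t * g' t)) Y"
  proof (rule op_ge_limit)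
    show "(\<lambda>n. cfc (\<lambda>t. mean_iteration n (f t) (f' t)) X) \<longlonglongrightarrow> cfc (\<lambda>t. sqrt (f t * f' t)) X"
      using it X by (intro cfc_uniform_limit mean_iteration_uniform_limit compact_real_spectrum)
        (auto simp: dominates_def)
    show "(\<lambda>n. cfc (\<lambda>t. mean_iteration n (g t) (g' t)) Y) \<longlonglongrightarrow> cfc (\<lambda>t. sqrt (g t * g' t)) Y"
      using it Y by (intro cfc_uniform_limit mean_iteration_uniform_limit compact_real_spectrum)
        (auto simp: dominates_def)
  qed (use it in \<open>auto simp: dominates_def\<close>)
  then show ?thesis
    using X Y by (auto simp: dominates_def intro!: continuous_intros)
qed

text \<open>
  An exponent with odd numerator \<open>2 j + 1\<close> over \<open>2\<^sup>n\<^sup>+\<^sup>1\<close> is the midpoint of \<open>j / 2\<^sup>n\<close> and \<open>(j + 1) / 2\<^sup>n\<close>,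
  and the geometric mean of two powers has the midpoint of their exponents as exponent.
\<close>

lemma dominates_dyadic_powr:
  fixes k n :: nat
  assumes fg: "dominates X Y f g" and "k \<le> 2 ^ n"
  shows "dominates X Y (\<lambda>t. f t powr (k / 2 ^ n)) (\<lambda>t. g t powr (k / 2 ^ n))"
  using assms(2)
proof (induction n arbitrary: k)
  case 0
  then consider "k = 0" | "k = 1"
    by fastforce
  then show ?case
  proof cases
    case 1
    have "dominates X Y (\<lambda>t. 1) (\<lambda>t. 1)"
      using fg by (intro dominates_one) (auto simp: dominates_def)
    then show ?thesis
      by (rule dominates_cong) (use fg 1 in \<open>force simp: dominates_def\<close>)+
  next
    case 2
    show ?thesis
      by (rule dominates_cong [OF fg]) (use fg 2 in \<open>auto simp: dominates_def less_imp_le\<close>)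
  qed
next
  case (Suc n)
  show ?case
  proof (cases "even k")
    case True
    then obtain j where j: "k = 2 * j"
      by blast
    with Suc.prems Suc.IH [of j] show ?thesis
      by simp
  next
    case False
    then obtain j where j: "k = 2 * j + 1"
      by (rule oddE)
    then have "j \<le> 2 ^ n" "j + 1 \<le> 2 ^ n"
      using Suc.prems by simp_all
    have mean: "sqrt (a powr (j / 2 ^ n) * a powr ((j + 1) / 2 ^ n)) = a powr (k / 2 ^ Suc n)" for a
    proof -
      have "sqrt (a powr (j / 2 ^ n) * a powr ((j + 1) / 2 ^ n))
          = (a powr (j / 2 ^ n + (j + 1) / 2 ^ n)) powr (1 / 2)"
        by (simp add: powr_add powr_half_sqrt)
      also have "\<dots> = a powr ((j / 2 ^ n + (j + 1) / 2 ^ n) * (1 / 2))"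
        by (rule powr_powr)
      also have "(j / 2 ^ n + (j + 1) / 2 ^ n) * (1 / 2) = k / 2 ^ Suc n"
        by (simp add: j field_simps)
      finally show ?thesis .
    qed
    show ?thesis
      using dominates_geometric_mean [OF Suc.IH [OF \<open>j \<le> 2 ^ n\<close>] Suc.IH [OF \<open>j + 1 \<le> 2 ^ n\<close>]]
      unfolding mean .
  qed
qed

text \<open>
  This serves both for exponents tending to \<open>r\<close> and for positive shifts tending to 0.
\<close>

lemma uniform_limit_parameter:
  fixes F :: "real \<Rightarrow> real \<Rightarrow> real"
  assumes K: "compact K" and F: "continuous_on (K \<times> {0..1}) (\<lambda>z. F (fst z) (snd z))"
    and s: "\<And>n. s n \<in> {0..1}" "s \<longlonglongrightarrow> l"
  shows "uniform_limit K (\<lambda>n t. F t (s n)) (\<lambda>t. F t l) sequentially"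
proof (rule uniform_limitI)
  fix e :: real
  assume "e > 0"
  moreover have "uniformly_continuous_on (K \<times> {0..1}) (\<lambda>z. F (fst z) (snd z))"
    by (intro compact_uniformly_continuous F compact_Times K compact_Icc)
  ultimately obtain d where d: "d > 0" "\<And>z w. z \<in> K \<times> {0..1} \<Longrightarrow> w \<in> K \<times> {0..1} \<Longrightarrow> dist w z < d
      \<Longrightarrow> dist (F (fst w) (snd w)) (F (fst z) (snd z)) < e"
    unfolding uniformly_continuous_on_def by metis
  have l: "l \<in> {0..1}"
    using closed_sequentially [OF closed_atLeastAtMost s(1) s(2)] .
  have "\<forall>\<^sub>F n in sequentially. dist (s n) l < d"
    using tendstoD [OF s(2) d(1)] .
  then show "\<forall>\<^sub>F n in sequentially. \<forall>t\<in>K. dist (F t (s n)) (F t l) < e"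
  proof eventually_elim
    case (elim n)
    show ?case
    proof
      fix t assume "t \<in> K"
      then show "dist (F t (s n)) (F t l) < e"
        using d(2) [of "(t, l)" "(t, s n)"] s(1) l elim by (simp add: dist_Pair_Pair)
    qed
  qed
qed

lemma dominates_powr:
  assumes fg: "dominates X Y f g" and r: "0 \<le> r" "r \<le> 1"
  shows "cfc (\<lambda>t. f t powr r) X \<ge>\<^sub>o\<^sub>p cfc (\<lambda>t. g t powr r) Y"
proof -
  define k where "k n = nat \<lfloor>r * 2 ^ n\<rfloor>" for n
  define s where "s n = real (k n) / 2 ^ n" for n
  have k: "real (k n) \<le> r * 2 ^ n" "r * 2 ^ n < real (k n) + 1" for n
    using r by (auto simp: k_def)
  have "k n \<le> 2 ^ n" for n
  proof -
    have "real (k n) \<le> 1 * 2 ^ n"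
      using r by (intro order_trans [OF k(1)] mult_right_mono) auto
    then show ?thesis
      by simp
  qed
  then have dyadic: "dominates X Y (\<lambda>t. f t powr s n) (\<lambda>t. g t powr s n)" for n
    unfolding s_def by (rule dominates_dyadic_powr [OF fg])
  have s_le: "s n \<le> r" for n
    using k(1) [of n] by (simp add: s_def divide_le_eq)
  have s_ge: "r - (1 / 2) ^ n \<le> s n" for n
  proof -
    have "r \<le> (real (k n) + 1) / 2 ^ n"
      using k(2) [of n] by (simp add: le_divide_eq)
    then show ?thesis
      by (simp add: s_def add_divide_distrib power_one_over)
  qed
  have "(\<lambda>n. r - (1 / 2) ^ n) \<longlonglongrightarrow> r - 0"
    by (intro tendsto_diff tendsto_const LIMSEQ_realpow_zero) auto
  then have s_lim: "s \<longlonglongrightarrow> r"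
    using s_le s_ge by (intro tendsto_sandwich [of "\<lambda>n. r - (1 / 2) ^ n" s _ "\<lambda>n. r"]) auto
  have s_unit: "s n \<in> {0..1}" for n
  proof -
    have "0 \<le> s n"
      by (simp add: s_def)
    then show ?thesis
      using s_le [of n] r by simp
  qed
  have lim: "uniform_limit K (\<lambda>n t. h t powr s n) (\<lambda>t. h t powr r) sequentially"
    if "compact K" "continuous_on K h" "\<And>t. t \<in> K \<Longrightarrow> 0 < h t" for K :: "real set" and h
  proof (rule uniform_limit_parameter [where F = "\<lambda>t s. h t powr s", OF that(1) _ s_unit s_lim])
    show "continuous_on (K \<times> {0..1}) (\<lambda>z. h (fst z) powr snd z)"
    proof (rule continuous_on_powr)
      show "continuous_on (K \<times> {0..1}) (\<lambda>z. h (fst z))"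
        by (rule continuous_on_compose2 [OF that(2) continuous_on_fst [OF continuous_on_id]]) auto
    qed (use that(3) in \<open>force intro: continuous_intros\<close>)+
  qed
  show ?thesis
  proof (rule op_ge_limit)
    show "(\<lambda>n. cfc (\<lambda>t. f t powr s n) X) \<longlonglongrightarrow> cfc (\<lambda>t. f t powr r) X"
      using fg dyadic by (intro cfc_uniform_limit lim compact_real_spectrum) (auto simp: dominates_def)
    show "(\<lambda>n. cfc (\<lambda>t. g t powr s n) Y) \<longlonglongrightarrow> cfc (\<lambda>t. g t powr r) Y"
      using fg dyadic by (intro cfc_uniform_limit lim compact_real_spectrum) (auto simp: dominates_def)
  qed (use dyadic in \<open>auto simp: dominates_def\<close>)
qed

text \<open>
  The functions may vanish, so the positive functions \<open>f + s\<close> and \<open>g + s\<close> are used first and then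
  \<open>s\<close> tends to 0.
\<close>

theorem Loewner_Heinz:
  assumes X: "selfadjoint_op X" "continuous_on (real_spectrum X) f"
      "\<And>t. t \<in> real_spectrum X \<Longrightarrow> 0 \<le> f t"
    and Y: "selfadjoint_op Y" "continuous_on (real_spectrum Y) g"
      "\<And>t. t \<in> real_spectrum Y \<Longrightarrow> 0 \<le> g t"
    and ge: "cfc f X \<ge>\<^sub>o\<^sub>p cfc g Y" and r: "0 < r" "r \<le> 1"
  shows "cfc (\<lambda>t. f t powr r) X \<ge>\<^sub>o\<^sub>p cfc (\<lambda>t. g t powr r) Y"
proof -
  define s where "s n = inverse (real (Suc n))" for n
  have s: "0 < s n" "s n \<in> {0..1}" for n
    by (simp_all add: s_def field_simps)
  have "dominates X Y (\<lambda>t. f t + s n) (\<lambda>t. g t + s n)" for n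
  proof -
    have "cfc (\<lambda>t. f t + s n) X = cfc f X + scalar_op (s n)"
      "cfc (\<lambda>t. g t + s n) Y = cfc g Y + scalar_op (s n)"
      using X Y by (simp_all add: cfc_add cfc_const)
    then have "cfc (\<lambda>t. f t + s n) X \<ge>\<^sub>o\<^sub>p cfc (\<lambda>t. g t + s n) Y"
      using ge by (simp add: op_ge_def selfadjoint_op_add selfadjoint_op_scalar blinfun.add_left
          cinner_add_left)
    then show ?thesis
      using X Y s(1) by (auto simp: dominates_def add_nonneg_pos intro!: continuous_intros)
  qed
  then have shifted: "cfc (\<lambda>t. (f t + s n) powr r) X \<ge>\<^sub>o\<^sub>p cfc (\<lambda>t. (g t + s n) powr r) Y" for n
    using r by (intro dominates_powr) auto
  have "s \<longlonglongrightarrow> 0"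
    unfolding s_def by (rule LIMSEQ_inverse_real_of_nat)
  have lim: "uniform_limit K (\<lambda>n t. (h t + s n) powr r) (\<lambda>t. h t powr r) sequentially"
    if "compact K" "continuous_on K h" "\<And>t. t \<in> K \<Longrightarrow> 0 \<le> h t" for K :: "real set" and h
  proof -
    have "continuous_on (K \<times> {0..1::real}) (\<lambda>z. h (fst z))"
      by (rule continuous_on_compose2 [OF that(2) continuous_on_fst [OF continuous_on_id]]) auto
    then have "continuous_on (K \<times> {0..1}) (\<lambda>z. (h (fst z) + snd z) powr r)"
      using r that(3) by (intro continuous_on_powr' continuous_intros) auto
    from uniform_limit_parameter [where F = "\<lambda>t s. (h t + s) powr r", OF that(1) this s(2) \<open>s \<longlonglongrightarrow> 0\<close>]
    show ?thesis
      by simp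
  qed
  have cont: "continuous_on K (\<lambda>t. (h t + s n) powr r)"
    if "continuous_on K h" "\<And>t. t \<in> K \<Longrightarrow> 0 \<le> h t" for K h n
    using that r less_imp_le [OF s(1) [of n]]
    by (intro continuous_on_powr' continuous_on_add continuous_on_const) auto
  show ?thesis
  proof (rule op_ge_limit [OF shifted])
    show "(\<lambda>n. cfc (\<lambda>t. (f t + s n) powr r) X) \<longlonglongrightarrow> cfc (\<lambda>t. f t powr r) X"
      by (intro cfc_uniform_limit lim cont compact_real_spectrum X)
    show "(\<lambda>n. cfc (\<lambda>t. (g t + s n) powr r) Y) \<longlonglongrightarrow> cfc (\<lambda>t. g t powr r) Y"
      by (intro cfc_uniform_limit lim cont compact_real_spectrum Y)
  qed
qed

section \<open>The lower bound for the difference of powers\<close>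

text \<open>The derivative \<open>r (t\<^sup>r\<^sup>-\<^sup>1 - (t - m)\<^sup>r\<^sup>-\<^sup>1)\<close> is at most 0 because the exponent \<open>r - 1\<close> is.\<close>

lemma powr_diff_shift_antimono:
  fixes m r s t :: real
  assumes r: "0 < r" "r \<le> 1" and m: "0 < m" and t: "m \<le> t" "t \<le> s"
  shows "s powr r - (s - m) powr r \<le> t powr r - (t - m) powr r"
  using t(2)
proof (rule DERIV_nonpos_imp_decreasing_open [where f = "\<lambda>u. u powr r - (u - m) powr r"])
  fix u assume u: "t < u" "u < s"
  have "((\<lambda>u. u powr r - (u - m) powr r) has_real_derivative
      r * u powr (r - 1) - r * (u - m) powr (r - 1)) (at u)"
    using u t m by (auto intro!: derivative_eq_intros)
  moreover have "u powr (r - 1) \<le> (u - m) powr (r - 1)"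
    using u t m r by (intro powr_mono2') auto
  then have "r * u powr (r - 1) - r * (u - m) powr (r - 1) \<le> 0"
    using r by (simp add: mult_left_mono)
  ultimately show "\<exists>y. ((\<lambda>u. u powr r - (u - m) powr r) has_real_derivative y) (at u) \<and> y \<le> 0"
    by blast
next
  show "continuous_on {t..s} (\<lambda>u. u powr r - (u - m) powr r)"
    using t m r
    by (intro continuous_on_diff continuous_on_powr' continuous_on_id continuous_on_const) auto
qed

theorem theorem2p3:
  fixes A B :: "'a::complex_hilbert_space \<Rightarrow>\<^sub>L 'a" and m r :: real
  assumes "\<exists>x::'a. x \<noteq> 0"
    and "positive_op A" and "positive_op B"
    and "A - B \<ge>\<^sub>o\<^sub>p scalar_op m" and "m > 0"
    and "0 < r" and "r \<le> 1"
  shows "op_powr A r - op_powr B r \<ge>\<^sub>o\<^sub>p scalar_op (norm A powr r - (norm A - m) powr r)"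
proof -
  note r = \<open>0 < r\<close> \<open>r \<le> 1\<close>
  define c where "c = norm A powr r - (norm A - m) powr r"
  have A: "selfadjoint_op A" and B: "selfadjoint_op B" and B0: "B \<ge>\<^sub>o\<^sub>p scalar_op 0"
    using assms(2,3) by (auto simp: positive_op_def op_ge_def scalar_op_def)
  have AmB: "A - scalar_op m \<ge>\<^sub>o\<^sub>p B"
    using assms(4) A B unfolding op_ge_def
    by (auto simp: selfadjoint_op_diff selfadjoint_op_scalar blinfun.diff_left cinner.diff_left
        algebra_simps)
  have "A \<ge>\<^sub>o\<^sub>p scalar_op m"
    unfolding op_ge_def
  proof (intro conjI allI A selfadjoint_op_scalar)
    fix x
    show "Re (cinner (blinfun_apply (scalar_op m) x) x) \<le> Re (cinner (blinfun_apply A x) x)"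
      using op_geD [OF AmB, of x] op_geD [OF B0, of x]
      by (simp add: blinfun.diff_left cinner.diff_left cinner.zero_left)
  qed
  then have spA: "m \<le> t" "t \<le> norm A" if "t \<in> real_spectrum A" for t
    using that real_spectrum_lower_bound real_spectrum_le_norm [OF A] by fastforce+
  have spB: "0 \<le> t" if "t \<in> real_spectrum B" for t
    using that real_spectrum_lower_bound [OF B0] by simp
  have contA: "continuous_on (real_spectrum A) (\<lambda>t. t powr r)"
    "continuous_on (real_spectrum A) (\<lambda>t. (t - m) powr r)"
    using spA \<open>m > 0\<close> r
    by (intro continuous_on_powr' continuous_on_diff continuous_on_id continuous_on_const; force)+
  have "cfc (\<lambda>t. (t - m) powr r) A \<ge>\<^sub>o\<^sub>p cfc (\<lambda>t. t powr r) B"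
  proof (rule Loewner_Heinz [OF A _ _ B])
    show "cfc (\<lambda>t. t - m) A \<ge>\<^sub>o\<^sub>p cfc (\<lambda>t. t) B"
      using AmB by (simp add: cfc_diff cfc_ident cfc_const A B)
  qed (use spA spB r in \<open>auto intro!: continuous_intros\<close>)
  moreover have "cfc (\<lambda>t. t powr r - (t - m) powr r) A \<ge>\<^sub>o\<^sub>p cfc (\<lambda>t. c) A"
  proof (rule cfc_mono [OF A])
    show "c \<le> t powr r - (t - m) powr r" if "t \<in> real_spectrum A" for t
      unfolding c_def using spA [OF that] \<open>m > 0\<close> r by (intro powr_diff_shift_antimono) auto
  qed (use contA in \<open>auto intro!: continuous_intros\<close>)
  then have "op_powr A r - cfc (\<lambda>t. (t - m) powr r) A \<ge>\<^sub>o\<^sub>p scalar_op c"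
    by (simp add: cfc_diff contA A cfc_const op_powr_def)
  moreover have "selfadjoint_op (op_powr A r)"
    unfolding op_powr_def by (rule selfadjoint_cfc [OF A contA(1)])
  ultimately show ?thesis
    unfolding op_powr_def [of B] c_def [symmetric] op_ge_def blinfun.diff_left cinner.diff_left
    by (auto simp: selfadjoint_op_diff intro: order_trans [OF _ diff_left_mono])
qed

end
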